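(* Let $G=(V,E)$ be a directed graph with $n$ nodes, $c\in(0,1)$, $\varepsilon>0$, $\delta\in(0,1)$, $j_0\in\{0,\dots,n\}$. Suppose the query node $u$ is chosen uniformly at random from $V$. Then the expected query cost $C$ of the PRSim Query Algorithm (described in the context) satisfies $\mathrm{E}[C]=O\!\left(\frac{n\log\frac n\delta}{\varepsilon^2}\cdot\sum_{w\in V}\pi(w)^2\right)$.
   Context: For $v\in V$, $\mathcal{I}(v)$, $\mathcal{O}(v)$ are in-/out-neighbor sets, $d_{in}(v)=|\mathcal I(v)|$. A $\sqrt{c}$-walk from $u$ starts at $u$ and at each step either terminates with probability $1-\sqrt{c}$ or, with probability $\sqrt{c}$, moves to a uniformly random in-neighbor. Two walks meet if they are at the same node after the same number of steps. $\pi_\ell(u,w)$ is the probability that a $\sqrt{c}$-walk from $u$ terminates at $w$ after exactly $\ell$ steps; $\pi(w)=\frac1n\sum_u\sum_\ell\pi_\ell(u,w)$ is the reverse PageRank. Order nodes as $w_1,\dots,w_n$ with $\pi(w_1)\ge\dots\ge\pi(w_n)$; $w_1,\dots,w_{j_0}$ are hub nodes. Constants in $O(\cdot)$ may depend on $c$. Index: for each hub $w$, backward search with $r_{max}=\frac{(1-\sqrt c)^2\varepsilon}{12}$: residues $r_\ell(v,w)$ and reserves $\psi_\ell(v,w)$ start at $0$ except $r_0(w,w)=1$; for $\ell=0,1,\dots$, for each $v$ with $r_\ell(v,w)>r_{max}$: add $\sqrt c\,r_\ell(v,w)/d_{in}(z)$ to $r_{\ell+1}(z,w)$ for each $z\in\mathcal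 O(v)$, add $(1-\sqrt c)r_\ell(v,w)$ to $\psi_\ell(v,w)$, set $r_\ell(v,w)=0$; then store in list $L_\ell(w)$ the tuples $(v,\psi_\ell(v,w))$ with $\psi_\ell(v,w)>r_{max}$. Variance Bounded Backward Walk (VBBW) on $w$, target level $\ell$ (out-adjacency lists sorted by ascending in-degree; scans stop at the first neighbor violating the bound): $\hat\pi_i(x,w)=0$ except $\hat\pi_0(w,w)=1-\sqrt c$; for $i=0,\dots,\ell-1$, for each $x$ with $\hat\pi_i(x,w)\ne0$, independently with probability $\sqrt c$: add $\hat\pi_i(x,w)/d_{in}(y)$ to $\hat\pi_{i+1}(y,w)$ for each $y\in\mathcal O(x)$ with $d_{in}(y)\le\hat\pi_i(x,w)/(1-\sqrt c)$; draw $r$ uniform in $(0,1)$ and add $1-\sqrt c$ to $\hat\pi_{i+1}(y,w)$ for each $y\in\mathcal O(x)$ with $\hat\pi_i(x,w)/(1-\sqrt c)<d_{in}(y)\le \hat\pi_i(x,w)/(r(1-\sqrt c))$; output $\hat\pi_\ell(\cdot,w)$. PRSim Query Algorithm on $u$: $c_1=\frac{12}{(1-\sqrt c)^2}$, $d_r=c_1/\varepsilon^2$, $f_r=3\log\frac n\delta$, $n_r=d_rf_r$; all estimators start at $0$ (stored sparsely in hash maps). For $i=1,\dots,f_r$ and $j=1,\dots,d_r$: sample a $\sqrt c$-walk from $u$, say terminating at $w$ after $\ell$ steps; sample two independent $\sqrt c$-walks from $w$; if they do not meet at any step $\ge1$: add $1/n_r$ to $\widehat{\eta\pi}_\ell(u,w)$,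 and if $w$ is not a hub, run VBBW on $w$ with target level $\ell$ and add $\frac{\hat\pi_\ell(v,w)}{(1-\sqrt c)^2d_r}$ to $\hat s_B^i(u,v)$ for every $v$ with nonzero $\hat\pi_\ell(v,w)$. Then $\hat s_B(u,v)=\mathrm{Median}_{1\le i\le f_r}\hat s_B^i(u,v)$ for $v$ with some nonzero $\hat s_B^i(u,v)$, and for every pair $(w,\ell)$ with $w$ a hub and $\widehat{\eta\pi}_\ell(u,w)>\varepsilon/c_1$, every tuple $(v,\psi_\ell(v,w))\in L_\ell(w)$ is read and $\frac{\widehat{\eta\pi}_\ell(u,w)\psi_\ell(v,w)}{(1-\sqrt c)^2}$ is added to $\hat s_I(u,v)$. Output all nonzero $\hat s_I(u,v)+\hat s_B(u,v)$. The query cost $C$ is the total running time of this procedure on $u$. *)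

theory Defs
  imports "HOL-Probability.Probability" "Graph_Theory.Pair_Digraph"
begin

section \<open>Graphs and \<open>\<surd>c\<close>-walks\<close>

definition in_nbrs :: "'v pair_pre_digraph \<Rightarrow> 'v \<Rightarrow> 'v set" where
  "in_nbrs G v = {x. (x, v) \<in> parcs G}"

definition out_nbrs :: "'v pair_pre_digraph \<Rightarrow> 'v \<Rightarrow> 'v set" where
  "out_nbrs G v = {y. (v, y) \<in> parcs G}"

definition d_in :: "'v pair_pre_digraph \<Rightarrow> 'v \<Rightarrow> nat" where
  "d_in G v = card (in_nbrs G v)"

definition sorted_out_adjacency :: "'v pair_pre_digraph \<Rightarrow> ('v \<Rightarrow> 'v list) \<Rightarrow> bool" where
  "sorted_out_adjacency G adj \<longleftrightarrow>
     (\<forall>x\<in>pverts G. distinct (adj x) \<and> set (adj x) = out_nbrs G x \<and> sorted (map (d_in G) (adj x)))"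

text \<open>
  A walk is returned as the list of its nodes, starting with the start node, together with a flag
  telling whether it terminated.  The flag is \<^const>\<open>False\<close> only if the walk was to move but its
  current node has no in-neighbour: such a walk is over, but does not count as terminating at that
  node.  This is the convention under which backward search and the backward walk below estimate
  the termination probabilities.
\<close>
partial_function (spmf) sqrt_walk ::
    "'v pair_pre_digraph \<Rightarrow> real \<Rightarrow> 'v \<Rightarrow> (bool \<times> 'v list) spmf" where
  "sqrt_walk G c u =
     bind_spmf (spmf_of_pmf (bernoulli_pmf (sqrt c))) (\<lambda>move.
       if \<not> move then return_spmf (True, [u])
       else if in_nbrs G u = {} then return_spmf (False, [u])
       else bind_spmf (spmf_of_set (in_nbrs G u)) (\<lambda>x.
         map_spmf (\<lambda>(t, xs). (t, u # xs)) (sqrt_walk G c x)))"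

definition meet_later :: "'v list \<Rightarrow> 'v list \<Rightarrow> bool" where
  "meet_later xs ys \<longleftrightarrow> (\<exists>k\<ge>1. k < length xs \<and> k < length ys \<and> xs ! k = ys ! k)"

definition term_prob :: "'v pair_pre_digraph \<Rightarrow> real \<Rightarrow> nat \<Rightarrow> 'v \<Rightarrow> 'v \<Rightarrow> real" where
  "term_prob G c l u w =
     measure (measure_spmf (sqrt_walk G c u)) {(t, xs). t \<and> length xs = Suc l \<and> last xs = w}"

definition reverse_pagerank :: "'v pair_pre_digraph \<Rightarrow> real \<Rightarrow> 'v \<Rightarrow> real" where
  "reverse_pagerank G c w =
     1 / real (card (pverts G)) * (\<Sum>u\<in>pverts G. \<Sum>l. term_prob G c l u w)"

definition pagerank_order :: "'v pair_pre_digraph \<Rightarrow> real \<Rightarrow> 'v list \<Rightarrow> bool" where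
  "pagerank_order G c ws \<longleftrightarrow> distinct ws \<and> set ws = pverts G \<and>
     sorted_wrt (\<lambda>x y. reverse_pagerank G c x \<ge> reverse_pagerank G c y) ws"

section \<open>The index\<close>

definition c1 :: "real \<Rightarrow> real" where
  "c1 c = 12 / (1 - sqrt c)\<^sup>2"

definition r_max :: "real \<Rightarrow> real \<Rightarrow> real" where
  "r_max c \<epsilon> = (1 - sqrt c)\<^sup>2 * \<epsilon> / 12"

text \<open>
  Level \<open>l\<close> only pushes to level \<open>l + 1\<close>, so the order in which nodes are processed is immaterial;
  \<open>residue \<dots> l v\<close> is the residue that \<open>v\<close> has when level \<open>l\<close> is reached (before it is reset).
\<close>
primrec residue :: "'v pair_pre_digraph \<Rightarrow> real \<Rightarrow> real \<Rightarrow> 'v \<Rightarrow> nat \<Rightarrow> 'v \<Rightarrow> real" where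
  "residue G c \<epsilon> w 0 z = (if z = w then 1 else 0)"
| "residue G c \<epsilon> w (Suc l) z =
     (\<Sum>v \<in> {v\<in>pverts G. residue G c \<epsilon> w l v > r_max c \<epsilon> \<and> z \<in> out_nbrs G v}.
        sqrt c * residue G c \<epsilon> w l v / real (d_in G z))"

definition reserve :: "'v pair_pre_digraph \<Rightarrow> real \<Rightarrow> real \<Rightarrow> 'v \<Rightarrow> nat \<Rightarrow> 'v \<Rightarrow> real" where
  "reserve G c \<epsilon> w l v =
     (if residue G c \<epsilon> w l v > r_max c \<epsilon> then (1 - sqrt c) * residue G c \<epsilon> w l v else 0)"

definition index_list :: "'v pair_pre_digraph \<Rightarrow> real \<Rightarrow> real \<Rightarrow> 'v \<Rightarrow> nat \<Rightarrow> ('v \<times> real) set" where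
  "index_list G c \<epsilon> w l =
     {(v, reserve G c \<epsilon> w l v) | v. v \<in> pverts G \<and> reserve G c \<epsilon> w l v > r_max c \<epsilon>}"

section \<open>Variance bounded backward walk\<close>

text \<open>
  All procedures below return their result together with their running time.  An arithmetic
  operation, a coin flip, the inspection of one neighbour and an access to a hash map take one unit
  of time, up to a constant factor.  Sampling a walk takes one unit per node of the walk, which also
  pays for the meeting test and for the control of the loop the walk is sampled in.
\<close>

text \<open>
  The neighbours found by scanning \<open>ys\<close> with the threshold of a random \<open>r\<close>.  There are only
  finitely many possible results, so their distribution is discrete.
\<close>
definition random_scan ::
    "'v pair_pre_digraph \<Rightarrow> real \<Rightarrow> real \<Rightarrow> 'v list \<Rightarrow> 'v list pmf" where
  "random_scan G c a ys =
     Abs_pmf (distr (uniform_measure lborel {0<..<1}) (count_space UNIV)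
       (\<lambda>r. takeWhile (\<lambda>y. real (d_in G y) \<le> a / (r * (1 - sqrt c))) ys))"

lemma measure_pmf_random_scan:
  "measure_pmf (random_scan G c a ys) =
     distr (uniform_measure lborel {0<..<1}) (count_space UNIV)
       (\<lambda>r. takeWhile (\<lambda>y. real (d_in G y) \<le> a / (r * (1 - sqrt c))) ys)"
proof -
  let ?U = "uniform_measure lborel {0<..<1::real}"
  let ?g = "\<lambda>(ys :: 'a list) r. takeWhile (\<lambda>y. real (d_in G y) \<le> a / (r * (1 - sqrt c))) ys"
  interpret U: prob_space ?U
    by (rule prob_space_uniform_measure) auto
  have meas [measurable]: "?g ys \<in> ?U \<rightarrow>\<^sub>M count_space UNIV" for ys
  proof (induction ys)
    case (Cons y ys)
    have *: "?g (y # ys) =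
        (\<lambda>r. if real (d_in G y) \<le> a / (r * (1 - sqrt c)) then y # ?g ys r else [])"
      by auto
    have [measurable]: "(\<lambda>r. y # ?g ys r) \<in> ?U \<rightarrow>\<^sub>M count_space UNIV"
      using measurable_compose[OF Cons.IH, of "\<lambda>zs. y # zs" "count_space UNIV"] by simp
    show ?case
      unfolding * by measurable
  qed simp
  interpret D: prob_space "distr ?U (count_space UNIV) (?g ys)"
    by (rule U.prob_space_distr[OF meas])
  have takes: "takeWhile P ys \<in> (\<lambda>k. take k ys) ` UNIV" for P
    by (metis rangeI takeWhile_eq_take)
  have "AE xs in distr ?U (count_space UNIV) (?g ys). xs \<in> (\<lambda>k. take k ys) ` UNIV"
    by (subst AE_distr_iff[OF meas]) (auto intro!: AE_I2 takes)
  then have "AE xs in distr ?U (count_space UNIV) (?g ys).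
      measure (distr ?U (count_space UNIV) (?g ys)) {xs} \<noteq> 0"
    by (subst D.AE_support_countable) (auto intro!: exI[of _ "(\<lambda>k. take k ys) ` UNIV"])
  then show ?thesis
    unfolding random_scan_def by (subst Abs_pmf_inverse) (auto intro: D.prob_space_axioms)
qed

text \<open>
  The contribution of one node \<open>x\<close> of value \<open>a\<close> to the next level.  Each of the two scans
  inspects the neighbours it returns and one more step, for the violating neighbour or
  for the end of the list.
\<close>
definition vbbw_node ::
    "'v pair_pre_digraph \<Rightarrow> ('v \<Rightarrow> 'v list) \<Rightarrow> real \<Rightarrow> 'v \<Rightarrow> real \<Rightarrow> (('v \<Rightarrow> real) \<times> nat) pmf" where
  "vbbw_node G adj c x a =
     bind_pmf (bernoulli_pmf (sqrt c)) (\<lambda>push.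
       if \<not> push then return_pmf (\<lambda>_. 0, 1)
       else
         let P = (\<lambda>y. real (d_in G y) \<le> a / (1 - sqrt c));
             near = takeWhile P (adj x)
         in map_pmf (\<lambda>far.
              (\<lambda>y. if y \<in> set near then a / real (d_in G y)
                   else if y \<in> set far then 1 - sqrt c else 0,
               1 + (length near + 1) + (length far + 1)))
              (random_scan G c a (dropWhile P (adj x))))"

definition vbbw_level ::
    "'v pair_pre_digraph \<Rightarrow> ('v \<Rightarrow> 'v list) \<Rightarrow> real \<Rightarrow> ('v \<Rightarrow> real) \<Rightarrow> (('v \<Rightarrow> real) \<times> nat) pmf" where
  "vbbw_level G adj c p =
     (let F = {x\<in>pverts G. p x \<noteq> 0} in
      map_pmf (\<lambda>f. (\<lambda>y. \<Sum>x\<in>F. fst (f x) y, 1 + (\<Sum>x\<in>F. snd (f x))))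
        (Pi_pmf F (\<lambda>_. 0, 0) (\<lambda>x. vbbw_node G adj c x (p x))))"

primrec vbbw ::
    "'v pair_pre_digraph \<Rightarrow> ('v \<Rightarrow> 'v list) \<Rightarrow> real \<Rightarrow> 'v \<Rightarrow> nat \<Rightarrow> (('v \<Rightarrow> real) \<times> nat) pmf" where
  "vbbw G adj c w 0 = return_pmf (\<lambda>x. if x = w then 1 - sqrt c else 0, 1)"
| "vbbw G adj c w (Suc l) =
     bind_pmf (vbbw G adj c w l) (\<lambda>(p, k).
       map_pmf (\<lambda>(p', k'). (p', k + k')) (vbbw_level G adj c p))"

section \<open>The query algorithm\<close>

text \<open>
  \<open>k\<close> is an admissible number of iterations of a loop running from 1 to the real number \<open>x\<close>: \<open>x\<close>
  rounded down or, if \<open>x\<close> is at least 1, rounded up.  Rounding up an \<open>x\<close> below 1 is excluded, as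
  it is not bounded by a constant multiple of \<open>x\<close>.
\<close>
definition loop_count :: "real \<Rightarrow> nat \<Rightarrow> bool" where
  "loop_count x k \<longleftrightarrow> int k = \<lfloor>x\<rfloor> \<or> (1 \<le> x \<and> int k = \<lceil>x\<rceil>)"

primrec for_loop :: "'i list \<Rightarrow> ('i \<Rightarrow> 's \<Rightarrow> 's spmf) \<Rightarrow> 's \<Rightarrow> 's spmf" where
  "for_loop [] body s = return_spmf s"
| "for_loop (i # is) body s = bind_spmf (body i s) (for_loop is body)"

definition median :: "real list \<Rightarrow> real" where
  "median xs = (sort xs ! ((length xs - 1) div 2) + sort xs ! (length xs div 2)) / 2"

record 'v query_state =
  eta_pi :: "nat \<Rightarrow> 'v \<Rightarrow> real"
  s_B :: "nat \<Rightarrow> 'v \<Rightarrow> real"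
  time :: nat

definition sample_step ::
    "'v pair_pre_digraph \<Rightarrow> ('v \<Rightarrow> 'v list) \<Rightarrow> real \<Rightarrow> 'v set \<Rightarrow> nat \<Rightarrow> nat \<Rightarrow> 'v \<Rightarrow> nat \<Rightarrow>
      'v query_state \<Rightarrow> 'v query_state spmf" where
  "sample_step G adj c hubs d_r f_r u i s =
     bind_spmf (sqrt_walk G c u) (\<lambda>(t, xs).
       let s1 = s\<lparr>time := time s + length xs\<rparr>; w = last xs; l = length xs - 1 in
       if \<not> t then return_spmf s1
       else
         bind_spmf (sqrt_walk G c w) (\<lambda>(_, ys).
         bind_spmf (sqrt_walk G c w) (\<lambda>(_, zs).
           let s2 = s1\<lparr>time := time s1 + length ys + length zs\<rparr> in
           if meet_later ys zs then return_spmf s2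
           else
             let s3 = s2\<lparr>eta_pi := (eta_pi s2)(l := (eta_pi s2 l)
                            (w := eta_pi s2 l w + 1 / (real d_r * real f_r))),
                         time := time s2 + 1\<rparr> in
             if w \<in> hubs then return_spmf s3
             else
               map_spmf (\<lambda>(p, k). s3
                   \<lparr>s_B := (s_B s3)(i := (\<lambda>v. s_B s3 i v + p v / ((1 - sqrt c)\<^sup>2 * real d_r))),
                    time := time s3 + k + card {v\<in>pverts G. p v \<noteq> 0}\<rparr>)
                 (spmf_of_pmf (vbbw G adj c w l)))))"

text \<open>
  Combining the estimators.  The running time consists of the entries of \<open>eta_pi\<close> that are
  examined, the tuples read from the index, the medians and the output.  Since the estimators are
  stored sparsely, the median for \<open>v\<close> is selected in time linear in the number of nonzero
  \<open>s_B i v\<close>; the zeros are implicit.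
\<close>
definition finish ::
    "'v pair_pre_digraph \<Rightarrow> real \<Rightarrow> real \<Rightarrow> 'v set \<Rightarrow> nat \<Rightarrow> 'v query_state \<Rightarrow> ('v \<times> real) set \<times> nat" where
  "finish G c \<epsilon> hubs f_r s =
     (let touched = {v\<in>pverts G. \<exists>i\<in>{1..f_r}. s_B s i v \<noteq> 0};
          sB = (\<lambda>v. if v \<in> touched then median (map (\<lambda>i. s_B s i v) [1..<Suc f_r]) else 0);
          read = {(w, l). w \<in> hubs \<and> eta_pi s l w > \<epsilon> / c1 c};
          sI = (\<lambda>v. \<Sum>(w, l)\<in>read. \<Sum>(v', q)\<in>index_list G c \<epsilon> w l.
                  if v' = v then eta_pi s l w * q / (1 - sqrt c)\<^sup>2 else 0)
      in ({(v, sI v + sB v) | v. v \<in> pverts G \<and> sI v + sB v \<noteq> 0},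
          time s
          + card {(w, l). eta_pi s l w \<noteq> 0}
          + (\<Sum>(w, l)\<in>read. card (index_list G c \<epsilon> w l))
          + (\<Sum>v\<in>touched. card {i\<in>{1..f_r}. s_B s i v \<noteq> 0})
          + card (touched \<union> {v\<in>pverts G. sI v \<noteq> 0})))"

definition prsim_query ::
    "'v pair_pre_digraph \<Rightarrow> ('v \<Rightarrow> 'v list) \<Rightarrow> real \<Rightarrow> real \<Rightarrow> 'v set \<Rightarrow> nat \<Rightarrow> nat \<Rightarrow> 'v \<Rightarrow>
      (('v \<times> real) set \<times> nat) spmf" where
  "prsim_query G adj c \<epsilon> hubs d_r f_r u =
     map_spmf (finish G c \<epsilon> hubs f_r)
       (for_loop [1..<Suc f_r] (\<lambda>i.
          for_loop [1..<Suc d_r] (\<lambda>_. sample_step G adj c hubs d_r f_r u i))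
        \<lparr>eta_pi = (\<lambda>_ _. 0), s_B = (\<lambda>_ _. 0), time = 0\<rparr>)"

text \<open>The outcome \<^const>\<open>None\<close> of an \<open>spmf\<close> stands for nontermination.\<close>
definition expected_cost :: "('r \<times> nat) spmf \<Rightarrow> ennreal" where
  "expected_cost p =
     (\<integral>\<^sup>+ r. (case r of None \<Rightarrow> \<infinity> | Some (_, t) \<Rightarrow> of_nat t) \<partial>measure_pmf p)"

end

theory Submission
  imports Defs
begin

text \<open>
  Write \<open>\<pi>\<close> for the reverse PageRank.  The backward walk is unbiased, and all its nonzero
  values are at least \<open>1 - \<surd>c\<close>; hence the expected number of entries it ever touches, and with
  it the expected time of a walk on \<open>w\<close>, is \<open>O(l + n \<pi> w)\<close>.  A query samples \<open>w\<close> (summed over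
  the levels) with probability \<open>\<Sum>l. \<pi>\<^sub>l u w\<close>, whose mean over \<open>u\<close> is \<open>\<pi> w\<close>, so a
  sample costs \<open>O(1 + n \<Sum>w. (\<pi> w)\<^sup>2)\<close> in the mean.  By Markov's inequality the reading of the
  index is paid for by the samples that raise the estimators, as every list has length
  \<open>O(n \<pi> w / \<epsilon>)\<close>.  The constant term is absorbed because \<open>\<pi> w \<ge> (1 - \<surd>c) / n\<close>, that is,
  \<open>n \<Sum>w. (\<pi> w)\<^sup>2 \<ge> (1 - \<surd>c)\<^sup>2\<close>, and a logarithm is bounded from below as soon as a single
  sample is taken.
\<close>

section \<open>Expectations of subprobability mass functions\<close>

text \<open>
  The value \<open>b\<close> of nontermination lets one recursion serve three purposes: \<open>b = \<infinity>\<close> for costs,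
  \<open>b = 0\<close> for integrals over the subprobability, and \<open>b = 1\<close> with \<open>f = 0\<close> for the probability of
  nontermination.
\<close>
definition nn_expect :: "ennreal \<Rightarrow> 'a spmf \<Rightarrow> ('a \<Rightarrow> ennreal) \<Rightarrow> ennreal" where
  "nn_expect b p f = (\<integral>\<^sup>+ r. (case r of None \<Rightarrow> b | Some x \<Rightarrow> f x) \<partial>measure_pmf p)"

lemma nn_expect_return [simp]: "nn_expect b (return_spmf x) f = f x"
  by (simp add: nn_expect_def)

lemma nn_expect_bind: "nn_expect b (bind_spmf p g) f = nn_expect b p (\<lambda>x. nn_expect b (g x) f)"
  unfolding nn_expect_def bind_spmf_def
  by (auto intro!: nn_integral_cong simp: split: option.split)

lemma nn_expect_map: "nn_expect b (map_spmf h p) f = nn_expect b p (\<lambda>x. f (h x))"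
  unfolding map_spmf_conv_bind_spmf by (simp add: nn_expect_bind)

lemma nn_expect_spmf_of_pmf: "nn_expect b (spmf_of_pmf p) f = (\<integral>\<^sup>+ x. f x \<partial>measure_pmf p)"
  by (simp add: nn_expect_def spmf_of_pmf_def)

lemma nn_expect_spmf_of_set:
  assumes "finite A" "A \<noteq> {}"
  shows "nn_expect b (spmf_of_set A) f = (\<Sum>x\<in>A. f x) / of_nat (card A)"
  using assms
  by (simp add: nn_expect_spmf_of_pmf nn_integral_pmf_of_set flip: spmf_of_pmf_pmf_of_set)

lemma nn_expect_mono:
  assumes "\<And>x. x \<in> set_spmf p \<Longrightarrow> f x \<le> g x"
  shows "nn_expect b p f \<le> nn_expect b p g"
  unfolding nn_expect_def
  by (intro nn_integral_mono_AE)
    (auto simp: AE_measure_pmf_iff in_set_spmf intro: assms split: option.split)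

lemma nn_expect_zero: "nn_expect 0 p f = (\<integral>\<^sup>+ x. f x \<partial>measure_spmf p)"
  unfolding nn_expect_def measure_spmf_def
  by (subst nn_integral_distr)
    (auto intro!: nn_integral_cong split: option.split
      simp: measurable_restrict_space1 nn_integral_restrict_space indicator_def)

text \<open>The outcome \<open>None\<close> has probability zero, so its value \<open>b\<close> does
  not matter. For terminating walks this makes linearity and monotone convergence available even
  with \<open>b = \<infinity>\<close>.\<close>

lemma nn_expect_lossless:
  assumes "lossless_spmf p"
  shows "nn_expect b p f = (\<integral>\<^sup>+ x. f x \<partial>measure_spmf p)"
proof -
  have "nn_expect b p f = nn_expect 0 p f"
    using assms unfolding nn_expect_def lossless_iff_pmf_None
    by (intro nn_integral_cong_AE)
      (auto simp: AE_measure_pmf_iff set_pmf_iff split: option.split)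
  then show ?thesis
    by (simp add: nn_expect_zero)
qed

lemma expected_cost_conv: "expected_cost p = nn_expect \<infinity> p (\<lambda>(_, t). of_nat t)"
  unfolding expected_cost_def nn_expect_def ..

text \<open>The additive \<open>B'\<close> makes the rule applicable to its own conclusion, i.e. to nested loops.\<close>
lemma nn_expect_for_loop:
  assumes "\<And>i s B'. nn_expect b (body i s) (\<lambda>s. \<Phi> s + B') \<le> \<Phi> s + B + B'"
  shows "nn_expect b (for_loop is body s) (\<lambda>s. \<Phi> s + B') \<le> \<Phi> s + of_nat (length is) * B + B'"
proof (induction "is" arbitrary: s)
  case (Cons i "is")
  \<comment> \<open>The remaining iterations are charged in advance to the additive constant, so the
    premise on the body is used with \<open>of_nat (length is) * B + B'\<close>.\<close>
  have "nn_expect b (for_loop (i # is) body s) (\<lambda>s. \<Phi> s + B')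
      \<le> nn_expect b (body i s) (\<lambda>s. \<Phi> s + (of_nat (length is) * B + B'))"
    by (auto simp: nn_expect_bind add.assoc intro!: nn_expect_mono Cons.IH[unfolded add.assoc])
  also have "\<dots> \<le> \<Phi> s + B + (of_nat (length is) * B + B')"
    by (rule assms)
  finally show ?case
    by (simp add: algebra_simps)
qed simp

text \<open>\<open>ennreal\<close> sends negative numbers to 0 and is therefore subadditive without
  sign conditions; estimators and contributions in arbitrary states come without such
  conditions.\<close>

lemma ennreal_add_le: "ennreal (x + y) \<le> ennreal x + ennreal y"
  by (metis ennreal_leI ennreal_neg ennreal_plus add_decreasing add_decreasing2 add_0 add_0_right le_cases)

lemma ennreal_sum_le: "ennreal (\<Sum>x\<in>A. f x) \<le> (\<Sum>x\<in>A. ennreal (f x))"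
proof (induction A rule: infinite_finite_induct)
  case (insert x A)
  then show ?case
    by (simp add: order_trans[OF ennreal_add_le] add_left_mono)
qed auto

section \<open>Walks\<close>

locale sqrt_walks =
  fixes G :: "'v pair_pre_digraph" and c :: real
  assumes fin_digraph: "pair_fin_digraph G"
    and c_pos: "0 < c" and c_less: "c < 1"
begin

text \<open>The mean of a geometric distribution: the expected number of nodes of a walk that never
  gets stuck.\<close>

definition R :: real where "R = 1 / (1 - sqrt c)"

lemma sqrt_c: "0 < sqrt c" "sqrt c < 1"
  using c_pos c_less by auto

lemma R_pos: "0 < R"
  using sqrt_c by (simp add: R_def)

lemma R_mult: "R * (1 - sqrt c) = 1" "(1 - sqrt c) * R = 1"
  using sqrt_c by (simp_all add: R_def)

lemma finite_pverts: "finite (pverts G)"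
  using fin_digraph by (simp add: pair_fin_digraph.pair_finite_verts)

lemma in_nbrs_subset: "in_nbrs G v \<subseteq> pverts G"
  using fin_digraph pair_wf_digraph.in_arcsD1
  unfolding in_nbrs_def pair_fin_digraph_def pair_wf_digraph_def by auto

lemma out_nbrs_subset: "out_nbrs G v \<subseteq> pverts G"
  using fin_digraph
  unfolding out_nbrs_def pair_fin_digraph_def pair_wf_digraph_def by auto

lemma finite_in_nbrs: "finite (in_nbrs G v)"
  using in_nbrs_subset finite_pverts by (rule finite_subset)

lemma d_in_pos: "y \<in> out_nbrs G x \<Longrightarrow> 0 < d_in G y"
  using finite_in_nbrs by (auto simp: d_in_def card_gt_0_iff in_nbrs_def out_nbrs_def)

text \<open>The fixed-point equation of the walk as a recursion for expectations: coin flip, then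
  dead end or uniform in-neighbour. It is the basis of the inductions over levels and truncations
  below.\<close>

lemma nn_expect_sqrt_walk:
  "nn_expect b (sqrt_walk G c u) f =
     ennreal (1 - sqrt c) * f (True, [u]) +
     ennreal (sqrt c) * (if in_nbrs G u = {} then f (False, [u])
       else (\<Sum>x\<in>in_nbrs G u. nn_expect b (sqrt_walk G c x) (\<lambda>(t, xs). f (t, u # xs)))
         / of_nat (d_in G u))"
proof -
  have "nn_expect b (sqrt_walk G c u) f =
      (\<integral>\<^sup>+ move. nn_expect b (if \<not> move then return_spmf (True, [u])
        else if in_nbrs G u = {} then return_spmf (False, [u])
        else bind_spmf (spmf_of_set (in_nbrs G u)) (\<lambda>x.
          map_spmf (\<lambda>(t, xs). (t, u # xs)) (sqrt_walk G c x))) f \<partial>bernoulli_pmf (sqrt c))"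
    by (subst sqrt_walk.simps) (simp only: nn_expect_bind nn_expect_spmf_of_pmf)
  then show ?thesis
    using sqrt_c finite_in_nbrs[of u]
    by (simp add: nn_expect_bind nn_expect_spmf_of_set nn_expect_map d_in_def
        mult.commute add.commute case_prod_beta')
qed

lemma sqrt_walk_avg_le:
  assumes "\<And>x. x \<in> in_nbrs G u \<Longrightarrow> h x \<le> B"
  shows "(\<Sum>x\<in>in_nbrs G u. h x) / of_nat (d_in G u) \<le> (B :: ennreal)"
proof (cases "in_nbrs G u = {}")
  case False
  then have "d_in G u \<noteq> 0"
    using finite_in_nbrs by (simp add: d_in_def)
  have "(\<Sum>x\<in>in_nbrs G u. h x) \<le> of_nat (d_in G u) * B"
    using sum_mono[OF assms] by (simp add: d_in_def)
  then show ?thesis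
    using \<open>d_in G u \<noteq> 0\<close> by (simp add: divide_le_posI_ennreal mult.commute)
qed simp

text \<open>With \<open>b = 1\<close> and \<open>f = 0\<close> the expectation is the probability of
  nontermination. It is at most 1, and each unfolding gains a factor \<open>sqrt c\<close>, so it is
  below every \<open>sqrt c ^ k\<close>.\<close>

lemma lossless_sqrt_walk: "lossless_spmf (sqrt_walk G c u)"
proof -
  have le: "nn_expect 1 (sqrt_walk G c u) (\<lambda>_. 0) \<le> ennreal (sqrt c ^ k)" for k u
  proof (induction k arbitrary: u)
    case 0
    have "nn_expect 1 (sqrt_walk G c u) (\<lambda>_. 0) \<le> (\<integral>\<^sup>+ _. 1 \<partial>measure_pmf (sqrt_walk G c u))"
      unfolding nn_expect_def by (intro nn_integral_mono) (simp split: option.split)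
    then show ?case
      by simp
  next
    case (Suc k)
    have "(\<Sum>x\<in>in_nbrs G u. nn_expect 1 (sqrt_walk G c x) (\<lambda>(t, xs). 0)) / of_nat (d_in G u)
        \<le> ennreal (sqrt c ^ k)"
      using Suc.IH by (intro sqrt_walk_avg_le) (simp add: case_prod_beta')
    then show ?case
      using sqrt_c by (subst nn_expect_sqrt_walk) (auto simp: ennreal_mult intro: mult_left_mono)
  qed
  have "(\<lambda>k. ennreal (sqrt c ^ k)) \<longlonglongrightarrow> ennreal 0"
    using sqrt_c by (intro tendsto_ennrealI LIMSEQ_realpow_zero) auto
  then have "nn_expect 1 (sqrt_walk G c u) (\<lambda>_. 0) \<le> ennreal 0"
    by (rule LIMSEQ_le_const) (auto intro: le)
  moreover have "nn_expect 1 (sqrt_walk G c u) (\<lambda>_. 0)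
      = (\<integral>\<^sup>+ r. indicator {None} r \<partial>measure_pmf (sqrt_walk G c u))"
    unfolding nn_expect_def by (intro nn_integral_cong) (simp split: option.split)
  ultimately show ?thesis
    by (simp add: lossless_iff_pmf_None emeasure_pmf_single)
qed

lemma nn_expect_walk_add_const:
  "nn_expect b (sqrt_walk G c u) (\<lambda>x. f x + B) = nn_expect b (sqrt_walk G c u) f + B"
  using lossless_sqrt_walk[of u]
  by (simp add: nn_expect_lossless nn_integral_add measure_spmf.emeasure_eq_measure
      lossless_weight_spmfD flip: weight_spmf_def)

text \<open>
  The recursion for the expected length could also be satisfied by \<open>\<infinity>\<close>, hence the truncation.
\<close>
lemma expected_walk_length:
  "nn_expect b (sqrt_walk G c u) (\<lambda>(_, xs). of_nat (length xs)) \<le> ennreal R"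
proof -
  have le: "nn_expect b (sqrt_walk G c u) (\<lambda>(_, xs). of_nat (min (length xs) k)) \<le> ennreal R" for k u
  proof (induction k arbitrary: u)
    case (Suc k)
    have "(\<Sum>x\<in>in_nbrs G u. nn_expect b (sqrt_walk G c x)
          (\<lambda>(_, xs). of_nat (min (length (u # xs)) (Suc k)))) / of_nat (d_in G u) \<le> ennreal R + 1"
      using nn_expect_walk_add_const[of b _ "\<lambda>(_, xs). of_nat (min (length xs) k)" 1] Suc.IH
      by (intro sqrt_walk_avg_le)
        (simp add: case_prod_beta' add.commute add_left_mono)
    then have "nn_expect b (sqrt_walk G c u) (\<lambda>(_, xs). of_nat (min (length xs) (Suc k)))
        \<le> ennreal (1 - sqrt c) * 1 + ennreal (sqrt c) * (ennreal R + 1)"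
      \<comment> \<open>A stuck walk has length 1, which the bound \<open>ennreal R + 1\<close> of
        the moving case covers too.\<close>
      using mult_left_mono[of 1 "ennreal R + 1" "ennreal (sqrt c)"]
      by (subst nn_expect_sqrt_walk)
        (auto intro!: add_left_mono mult_left_mono simp del: length_Cons)
    also have "\<dots> = ennreal ((1 - sqrt c) + sqrt c * (R + 1))"
      using sqrt_c R_pos by (simp add: ennreal_mult ennreal_plus)
    \<comment> \<open>\<open>R\<close> is the fixed point of the recursion, so the bound is the same
      for every truncation and survives the limit below.\<close>
    also have "(1 - sqrt c) + sqrt c * (R + 1) = R"
      using R_mult by (simp add: algebra_simps)
    finally show ?case .
  qed (use R_pos in \<open>simp add: nn_expect_lossless lossless_sqrt_walk\<close>)
  have eq: "of_nat (length xs) = (SUP k. of_nat (min (length xs) k) :: ennreal)" for xs :: "'v list"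
    by (rule antisym) (auto intro!: SUP_upper2[of "length xs"] SUP_least simp: min_def)
  have "nn_expect b (sqrt_walk G c u) (\<lambda>(_, xs). of_nat (length xs))
      = (\<integral>\<^sup>+ w. (SUP k. of_nat (min (length (snd w)) k)) \<partial>measure_spmf (sqrt_walk G c u))"
    by (simp add: nn_expect_lossless lossless_sqrt_walk eq case_prod_beta')
  also have "\<dots> = (SUP k. \<integral>\<^sup>+ w. of_nat (min (length (snd w)) k) \<partial>measure_spmf (sqrt_walk G c u))"
    by (intro nn_integral_monotone_convergence_SUP)
      (auto simp: incseq_def le_fun_def)
  also have "\<dots> \<le> ennreal R"
    using le[of u] by (intro SUP_least) (simp add: nn_expect_lossless lossless_sqrt_walk case_prod_beta')
  finally show ?thesis .
qed

text \<open>The walk is not structurally recursive. The induction is on the length of the outcome,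
  from which each unfolding strips one node.\<close>

lemma set_sqrt_walk:
  assumes "(t, xs) \<in> set_spmf (sqrt_walk G c u)" "u \<in> pverts G"
  shows "xs \<noteq> [] \<and> last xs \<in> pverts G"
  using assms
proof (induction "length xs" arbitrary: xs u rule: less_induct)
  case less
  have "xs = [u] \<or> (\<exists>ys. \<exists>x\<in>in_nbrs G u. xs = u # ys \<and> (t, ys) \<in> set_spmf (sqrt_walk G c x))"
    using less.prems(1) finite_in_nbrs[of u]
    by (subst (asm) sqrt_walk.simps)
      (auto simp: set_bind_spmf bind_UNION simp del: bind_spmf_of_pmf split: if_splits)
  then show ?case
  proof (elim disjE exE bexE conjE)
    fix ys x assume *: "x \<in> in_nbrs G u" "xs = u # ys" "(t, ys) \<in> set_spmf (sqrt_walk G c x)"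
    then show ?thesis
      using less.hyps[of ys x] in_nbrs_subset[of u] by auto
  qed (use less.prems in auto)
qed

section \<open>Termination probabilities\<close>

lemma term_prob_nonneg: "0 \<le> term_prob G c l u w"
  by (simp add: term_prob_def)

lemma ennreal_term_prob:
  "ennreal (term_prob G c l u w) = nn_expect 0 (sqrt_walk G c u)
     (\<lambda>(t, xs). of_bool (t \<and> length xs = Suc l \<and> last xs = w))"
proof -
  have "(\<lambda>(t, xs). of_bool (t \<and> length xs = Suc l \<and> last xs = w))
      = (indicator {(t, xs). t \<and> length xs = Suc l \<and> last xs = w} :: bool \<times> 'v list \<Rightarrow> ennreal)"
    by (auto simp: fun_eq_iff indicator_def)
  then show ?thesis
    by (simp add: term_prob_def nn_expect_zero measure_spmf.emeasure_eq_measure)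
qed

lemma term_prob_0: "term_prob G c 0 u w = (if u = w then 1 - sqrt c else 0)"
proof -
  \<comment> \<open>A walk that moves prepends its start to a nonempty walk and so has at least two
    nodes; the moving branch contributes nothing at level 0.\<close>
  have *: "nn_expect 0 (sqrt_walk G c x) (\<lambda>(t, xs). of_bool (t \<and> xs = [] \<and> P xs)) = 0"
    if "x \<in> in_nbrs G v" for x v P
  proof -
    have "x \<in> pverts G"
      using that in_nbrs_subset by auto
    then have "nn_expect 0 (sqrt_walk G c x) (\<lambda>(t, xs). of_bool (t \<and> xs = [] \<and> P xs))
      \<le> nn_expect 0 (sqrt_walk G c x) (\<lambda>_. 0)"
      using set_sqrt_walk[of _ _ x] by (intro nn_expect_mono) fastforce
    then show ?thesis
      by (simp add: nn_expect_zero)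
  qed
  have "ennreal (term_prob G c 0 u w) = ennreal (if u = w then 1 - sqrt c else 0)"
    unfolding ennreal_term_prob by (subst nn_expect_sqrt_walk) (simp add: *)
  then show ?thesis
    using sqrt_c by (subst (asm) ennreal_inj) (auto simp: term_prob_nonneg)
qed

text \<open>First-step decomposition; backward search and the backward walk imitate this recursion.
  A stuck walk carries the flag \<open>False\<close> and counts 0, in agreement with the empty sum
  divided by 0.\<close>

lemma term_prob_Suc:
  "term_prob G c (Suc l) u w =
     sqrt c * (\<Sum>x\<in>in_nbrs G u. term_prob G c l x w) / real (d_in G u)"
proof -
  have *: "nn_expect 0 (sqrt_walk G c x)
        (\<lambda>(t, xs). of_bool (t \<and> length (u # xs) = Suc (Suc l) \<and> last (u # xs) = w))
      = ennreal (term_prob G c l x w)" for x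
    unfolding ennreal_term_prob
    by (intro arg_cong[of _ _ "nn_expect 0 _"]) (auto simp: fun_eq_iff)
  have "ennreal (term_prob G c (Suc l) u w)
      = ennreal (sqrt c) * ((\<Sum>x\<in>in_nbrs G u. ennreal (term_prob G c l x w)) / of_nat (d_in G u))"
    unfolding ennreal_term_prob[of "Suc l"]
    by (subst nn_expect_sqrt_walk) (simp add: *[simplified])
  also have "\<dots> = ennreal (sqrt c * (\<Sum>x\<in>in_nbrs G u. term_prob G c l x w) / real (d_in G u))"
  proof (cases "in_nbrs G u = {}")
    case False
    then have "d_in G u > 0"
      using finite_in_nbrs by (simp add: d_in_def card_gt_0_iff)
    then show ?thesis
      using sqrt_c
      by (simp add: ennreal_of_nat_eq_real_of_nat divide_ennreal sum_nonneg term_prob_nonneg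
          flip: ennreal_mult)
  qed simp
  finally show ?thesis
    using sqrt_c by (subst (asm) ennreal_inj) (auto simp: term_prob_nonneg sum_nonneg)
qed

text \<open>Level \<open>l\<close> requires \<open>l\<close> successful coin flips. The geometric
  decay makes the series over the levels converge.\<close>

lemma term_prob_le: "term_prob G c l u w \<le> sqrt c ^ l"
proof (induction l arbitrary: u)
  case (Suc l)
  have "(\<Sum>x\<in>in_nbrs G u. term_prob G c l x w) \<le> real (d_in G u) * sqrt c ^ l"
    using sum_mono[of "in_nbrs G u", OF Suc.IH] by (simp add: d_in_def)
  then have "(\<Sum>x\<in>in_nbrs G u. term_prob G c l x w) / real (d_in G u) \<le> sqrt c ^ l"
    using sqrt_c by (auto simp: divide_le_eq mult.commute)
  then show ?case
    using sqrt_c mult_left_mono[of _ _ "sqrt c"] by (fastforce simp: term_prob_Suc)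
qed (use sqrt_c in \<open>auto simp: term_prob_0\<close>)

lemma summable_term_prob: "summable (\<lambda>l. term_prob G c l u w)"
  by (rule summable_comparison_test'[where g = "\<lambda>l. sqrt c ^ l"])
    (use sqrt_c in \<open>auto simp: term_prob_nonneg term_prob_le summable_geometric\<close>)

definition total_term_prob :: "'v \<Rightarrow> 'v \<Rightarrow> real" where
  "total_term_prob u w = (\<Sum>l. term_prob G c l u w)"

text \<open>This is \<open>n\<close> times the reverse PageRank; the division by \<open>n\<close> is
  postponed to the end.\<close>

definition n_pagerank :: "'v \<Rightarrow> real" where
  "n_pagerank w = (\<Sum>u\<in>pverts G. total_term_prob u w)"

lemma total_term_prob_nonneg: "0 \<le> total_term_prob u w"
  unfolding total_term_prob_def by (intro suminf_nonneg summable_term_prob term_prob_nonneg)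

lemma n_pagerank_nonneg: "0 \<le> n_pagerank w"
  unfolding n_pagerank_def by (intro sum_nonneg total_term_prob_nonneg)

lemma reverse_pagerank_conv: "reverse_pagerank G c w = n_pagerank w / real (card (pverts G))"
  by (simp add: reverse_pagerank_def n_pagerank_def total_term_prob_def)

lemma sum_term_prob_le_n_pagerank:
  "(\<Sum>i\<le>l. \<Sum>u\<in>pverts G. term_prob G c i u w) \<le> n_pagerank w"
  unfolding n_pagerank_def total_term_prob_def
  by (subst sum.swap) (intro sum_mono sum_le_suminf summable_term_prob term_prob_nonneg; simp)

lemma term_prob_le_n_pagerank: "(\<Sum>u\<in>pverts G. term_prob G c l u w) \<le> n_pagerank w"
proof -
  have "(\<Sum>u\<in>pverts G. term_prob G c l u w) \<le> (\<Sum>i\<le>l. \<Sum>u\<in>pverts G. term_prob G c i u w)"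
    by (intro member_le_sum) (auto intro: sum_nonneg term_prob_nonneg)
  then show ?thesis
    using sum_term_prob_le_n_pagerank by (rule order_trans)
qed

text \<open>Already the walk from \<open>w\<close> that stops at once contributes this much.\<close>

lemma n_pagerank_ge:
  assumes "w \<in> pverts G"
  shows "1 - sqrt c \<le> n_pagerank w"
proof -
  have "term_prob G c 0 w w \<le> (\<Sum>u\<in>pverts G. term_prob G c 0 u w)"
    using assms finite_pverts by (intro member_le_sum) (auto intro: term_prob_nonneg)
  also have "\<dots> \<le> n_pagerank w"
    by (rule term_prob_le_n_pagerank)
  finally show ?thesis
    by (simp add: term_prob_0)
qed

text \<open>The indicator of terminating at \<open>w\<close> splits into indicators over the levels,
  and integrating termwise yields \<open>total_term_prob\<close>. A cost that depends on the end
  node alone is thus averaged with these weights.\<close>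

lemma nn_expect_walk_end:
  assumes "u \<in> pverts G"
  shows "nn_expect b (sqrt_walk G c u) (\<lambda>(t, xs). if t then g (last xs) else 0)
    \<le> (\<Sum>w\<in>pverts G. ennreal (total_term_prob u w) * g w)"
proof -
  have "nn_expect b (sqrt_walk G c u) (\<lambda>(t, xs). if t then g (last xs) else 0)
      \<le> nn_expect b (sqrt_walk G c u) (\<lambda>(t, xs). \<Sum>w\<in>pverts G.
          (\<Sum>l. of_bool (t \<and> length xs = Suc l \<and> last xs = w)) * g w)"
  proof (intro nn_expect_mono, clarify)
    fix t xs assume "(t, xs) \<in> set_spmf (sqrt_walk G c u)"
    then have xs: "xs \<noteq> []" "last xs \<in> pverts G"
      using set_sqrt_walk assms by auto
    show "(if t then g (last xs) else 0) \<le> (\<Sum>w\<in>pverts G.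
          (\<Sum>l. of_bool (t \<and> length xs = Suc l \<and> last xs = w)) * g w)"
    proof (cases t)
      case True
      \<comment> \<open>The level of a walk is one less than its number of nodes; this single term
        of the series suffices.\<close>
      have "(1 :: ennreal) = (\<Sum>l\<in>{length xs - 1}. of_bool (t \<and> length xs = Suc l \<and> last xs = last xs))"
        using True xs by simp
      also have "\<dots> \<le> (\<Sum>l. of_bool (t \<and> length xs = Suc l \<and> last xs = last xs))"
        by (rule sum_le_suminf) auto
      finally have "g (last xs) \<le> (\<Sum>l. of_bool (t \<and> length xs = Suc l \<and> last xs = last xs)) * g (last xs)"
        using mult_right_mono[of 1 _ "g (last xs)"] by simp
      also have "\<dots> \<le> (\<Sum>w\<in>pverts G.
          (\<Sum>l. of_bool (t \<and> length xs = Suc l \<and> last xs = w)) * g w)"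
        using xs finite_pverts by (intro member_le_sum) auto
      finally show ?thesis
        using True by simp
    qed simp
  qed
  also have "\<dots> = (\<Sum>w\<in>pverts G. (\<Sum>l. \<integral>\<^sup>+ (t, xs). of_bool (t \<and> length xs = Suc l \<and> last xs = w)
      \<partial>measure_spmf (sqrt_walk G c u)) * g w)"
    by (simp add: nn_expect_lossless lossless_sqrt_walk case_prod_beta' nn_integral_sum
        nn_integral_multc nn_integral_suminf)
  also have "\<dots> = (\<Sum>w\<in>pverts G. ennreal (total_term_prob u w) * g w)"
    by (simp add: total_term_prob_def suminf_ennreal2 term_prob_nonneg summable_term_prob
        ennreal_term_prob[unfolded nn_expect_zero, symmetric] flip: suminf_ennreal2)
  finally show ?thesis .
qed

section \<open>The index\<close>

text \<open>Backward search runs the recursion of \<open>term_prob\<close> but pushes only residues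
  above \<open>r_max\<close>. The dropped terms are dominated by nonnegative terms, so the result
  can only be smaller.\<close>

lemma residue_le: "(1 - sqrt c) * residue G c \<epsilon> w l v \<le> term_prob G c l v w"
proof (induction l arbitrary: v)
  case (Suc l)
  have "(1 - sqrt c) * residue G c \<epsilon> w (Suc l) v
      = (\<Sum>x \<in> {x\<in>pverts G. residue G c \<epsilon> w l x > r_max c \<epsilon> \<and> v \<in> out_nbrs G x}.
        sqrt c * ((1 - sqrt c) * residue G c \<epsilon> w l x) / real (d_in G v))"
    by (simp add: sum_distrib_left mult_ac)
  also have "\<dots> \<le> (\<Sum>x \<in> {x\<in>pverts G. residue G c \<epsilon> w l x > r_max c \<epsilon> \<and> v \<in> out_nbrs G x}.
        sqrt c * term_prob G c l x w / real (d_in G v))"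
    using sqrt_c by (intro sum_mono divide_right_mono mult_left_mono Suc.IH) auto
  also have "\<dots> \<le> (\<Sum>x \<in> in_nbrs G v. sqrt c * term_prob G c l x w / real (d_in G v))"
    using sqrt_c finite_in_nbrs
    by (intro sum_mono2) (auto simp: in_nbrs_def out_nbrs_def term_prob_nonneg)
  finally show ?case
    by (simp add: term_prob_Suc sum_distrib_left sum_divide_distrib)
qed (simp add: term_prob_0)

lemma index_list_eq:
  "index_list G c \<epsilon> w l =
     (\<lambda>v. (v, reserve G c \<epsilon> w l v)) ` {v\<in>pverts G. reserve G c \<epsilon> w l v > r_max c \<epsilon>}"
  by (auto simp: index_list_def)

lemma finite_index_list: "finite (index_list G c \<epsilon> w l)"
  unfolding index_list_eq using finite_pverts by auto

text \<open>Every stored reserve exceeds \<open>r_max\<close>, while the reserves of one level are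
  dominated by termination probabilities of total at most \<open>n_pagerank w\<close>.\<close>

lemma card_index_list:
  assumes "0 < \<epsilon>"
  shows "real (card (index_list G c \<epsilon> w l)) \<le> c1 c / \<epsilon> * n_pagerank w"
proof -
  let ?A = "{v\<in>pverts G. reserve G c \<epsilon> w l v > r_max c \<epsilon>}"
  have r_max: "0 < r_max c \<epsilon>" "1 / r_max c \<epsilon> = c1 c / \<epsilon>"
    using sqrt_c assms by (auto simp: r_max_def c1_def)
  have "real (card ?A) * r_max c \<epsilon> \<le> (\<Sum>v\<in>?A. reserve G c \<epsilon> w l v)"
    by (rule sum_bounded_below) auto
  also have "\<dots> \<le> (\<Sum>v\<in>?A. term_prob G c l v w)"
    by (intro sum_mono) (auto simp: reserve_def residue_le term_prob_nonneg)
  also have "\<dots> \<le> (\<Sum>v\<in>pverts G. term_prob G c l v w)"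
    using finite_pverts by (intro sum_mono2) (auto simp: term_prob_nonneg)
  also have "\<dots> \<le> n_pagerank w"
    by (rule term_prob_le_n_pagerank)
  finally have "real (card ?A) \<le> n_pagerank w * (1 / r_max c \<epsilon>)"
    using r_max by (simp add: field_simps)
  then show ?thesis
    unfolding r_max using card_image_le[of ?A "\<lambda>v. (v, reserve G c \<epsilon> w l v)"] finite_pverts
    by (simp add: index_list_eq mult.commute)
qed

section \<open>The variance bounded backward walk\<close>

text \<open>Events about the scan become events about the uniform \<open>r\<close>, so that their
  probabilities are lengths of subsets of the unit interval.\<close>

lemma measurable_scan:
  "(\<lambda>r. takeWhile (\<lambda>y. real (d_in G y) \<le> a / (r * (1 - sqrt c))) ys)
    \<in> uniform_measure lborel {0<..<1::real} \<rightarrow>\<^sub>M count_space UNIV" (is "?scan ys \<in> ?U \<rightarrow>\<^sub>M _")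
proof (induction ys)
  case (Cons y ys)
  have *: "?scan (y # ys) =
      (\<lambda>r. if real (d_in G y) \<le> a / (r * (1 - sqrt c)) then y # ?scan ys r else [])"
    by auto
  have [measurable]: "(\<lambda>r. y # ?scan ys r) \<in> ?U \<rightarrow>\<^sub>M count_space UNIV"
    using measurable_compose[OF Cons.IH, of "\<lambda>zs. y # zs" "count_space UNIV"] by simp
  show ?case
    unfolding * by measurable
qed simp

text \<open>A scan that returns \<open>y\<close> must have
  \<open>d_in G y \<le> a / (r * (1 - sqrt c))\<close>, which confines \<open>r\<close> to an
  interval whose length is the stated bound.\<close>

lemma emeasure_random_scan_le:
  assumes "0 \<le> a" "0 < d_in G y"
  shows "emeasure (measure_pmf (random_scan G c a ys)) {far. y \<in> set far}
    \<le> ennreal (a / ((1 - sqrt c) * real (d_in G y)))"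
proof -
  let ?U = "uniform_measure lborel {0<..<1::real}"
  let ?b = "a / ((1 - sqrt c) * real (d_in G y))"
  let ?scan = "\<lambda>r. takeWhile (\<lambda>y. real (d_in G y) \<le> a / (r * (1 - sqrt c))) ys"
  have b: "0 \<le> ?b"
    using assms sqrt_c by auto
  have "emeasure (measure_pmf (random_scan G c a ys)) {far. y \<in> set far}
      = emeasure ?U (?scan -` {far. y \<in> set far} \<inter> space ?U)"
    unfolding measure_pmf_random_scan by (rule emeasure_distr[OF measurable_scan]) simp
  also have "\<dots> = emeasure lborel ({0<..<1} \<inter> (?scan -` {far. y \<in> set far} \<inter> space ?U))"
    using measurable_sets[OF measurable_scan, of "{far. y \<in> set far}" a ys]
    by (subst emeasure_uniform_measure) (auto simp: divide_ennreal_def)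
  also have "\<dots> \<le> emeasure lborel {0..?b}"
    using assms sqrt_c
    by (intro emeasure_mono) (auto dest!: set_takeWhileD simp: field_simps)
  finally show ?thesis
    using b by simp
qed

lemma in_set_random_scan:
  assumes "far \<in> set_pmf (random_scan G c a ys)"
  shows "\<exists>k. far = take k ys"
proof -
  have "AE xs in measure_pmf (random_scan G c a ys). \<exists>k. xs = take k ys"
    unfolding measure_pmf_random_scan
    by (subst AE_distr_iff[OF measurable_scan]) (auto intro!: AE_I2 intro: takeWhile_eq_take)
  then show ?thesis
    using assms by (auto simp: AE_measure_pmf_iff)
qed

end

section \<open>Granular functions, and the pathwise and expected cost of the backward walk\<close>

locale backward_walks = sqrt_walks +
  fixes adj :: "'a \<Rightarrow> 'a list"
  assumes sorted_adj: "sorted_out_adjacency G adj"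
begin

lemma adj: "x \<in> pverts G \<Longrightarrow> distinct (adj x)" "x \<in> pverts G \<Longrightarrow> set (adj x) = out_nbrs G x"
  using sorted_adj by (auto simp: sorted_out_adjacency_def)

text \<open>The total of a granular function bounds the number of its nonzero entries.\<close>

definition granular :: "('a \<Rightarrow> real) \<Rightarrow> bool" where
  "granular p \<longleftrightarrow> (\<forall>y. p y = 0 \<or> 1 - sqrt c \<le> p y)"

lemma granular_nonneg: "granular p \<Longrightarrow> 0 \<le> p y"
  unfolding granular_def using sqrt_c by (metis diff_gt_0_iff_gt le_less less_le_trans)

lemma granular_sum: "(\<And>x. x \<in> A \<Longrightarrow> granular (f x)) \<Longrightarrow> granular (\<lambda>y. \<Sum>x\<in>A. f x y)"
proof (induction A rule: infinite_finite_induct)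
  case (insert x A)
  then have "granular (f x)" "granular (\<lambda>y. \<Sum>x\<in>A. f x y)"
    by auto
  then show ?case
    using insert.hyps granular_nonneg[of "f x"] granular_nonneg[of "\<lambda>y. \<Sum>x\<in>A. f x y"]
    unfolding granular_def by (simp, smt (verit))
qed (auto simp: granular_def)

lemma card_granular_le:
  assumes "granular p"
  shows "real (card {y\<in>pverts G. p y \<noteq> 0}) \<le> R * (\<Sum>y\<in>pverts G. p y)"
proof -
  have "real (card {y\<in>pverts G. p y \<noteq> 0}) * (1 - sqrt c) \<le> (\<Sum>y\<in>{y\<in>pverts G. p y \<noteq> 0}. p y)"
    using assms by (intro sum_bounded_below) (auto simp: granular_def)
  also have "\<dots> \<le> (\<Sum>y\<in>pverts G. p y)"
    using finite_pverts assms by (intro sum_mono2) (auto simp: granular_nonneg)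
  finally show ?thesis
    using sqrt_c by (simp add: R_def field_simps)
qed

text \<open>The bound of the first scan makes \<open>a / d_in\<close> at least
  \<open>1 - sqrt c\<close>, and the second scan adds exactly \<open>1 - sqrt c\<close>. The two
  scans return disjoint parts of the adjacency list, so the time is the number of entries written
  plus the coin flip and the two stopping steps.\<close>

lemma set_vbbw_node:
  assumes x: "x \<in> pverts G" and a: "1 - sqrt c \<le> a"
    and fk: "(f, k) \<in> set_pmf (vbbw_node G adj c x a)"
  shows "granular f" "card {y\<in>pverts G. f y \<noteq> 0} \<le> k" "k \<le> 3 + card {y\<in>pverts G. f y \<noteq> 0}"
proof -
  define P where "P = (\<lambda>y. real (d_in G y) \<le> a / (1 - sqrt c))"
  define near where "near = takeWhile P (adj x)"
  have "granular f \<and> card {y\<in>pverts G. f y \<noteq> 0} \<le> k \<and> k \<le> 3 + card {y\<in>pverts G. f y \<noteq> 0}"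
  proof (cases "k = 1 \<and> f = (\<lambda>_. 0)")
    case True
    then show ?thesis
      by (auto simp: granular_def)
  next
    case False
    then obtain far where far: "far \<in> set_pmf (random_scan G c a (dropWhile P (adj x)))"
      and f: "f = (\<lambda>y. if y \<in> set near then a / real (d_in G y)
                   else if y \<in> set far then 1 - sqrt c else 0)"
      and k: "k = 1 + (length near + 1) + (length far + 1)"
      using fk by (auto simp: vbbw_node_def P_def near_def Let_def split: if_splits)
    obtain m where m: "far = take m (dropWhile P (adj x))"
      using in_set_random_scan[OF far] by auto
    have d: "distinct (near @ dropWhile P (adj x))"
      using adj(1)[OF x] by (simp add: near_def)
    then have dist: "distinct near" "distinct far" "set near \<inter> set far = {}"
      using set_take_subset[of m "dropWhile P (adj x)"] by (auto simp: m)
    have sub: "set near \<union> set far \<subseteq> out_nbrs G x"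
      using adj(2)[OF x] set_take_subset[of m "dropWhile P (adj x)"]
      by (auto simp: m near_def dest: set_takeWhileD set_dropWhileD)
    have near_ge: "1 - sqrt c \<le> a / real (d_in G y)" if "y \<in> set near" for y
    proof -
      have "P y" "0 < d_in G y"
        using that sub d_in_pos[of y x] by (auto simp: near_def dest: set_takeWhileD)
      then show ?thesis
        using sqrt_c by (auto simp: P_def field_simps)
    qed
    have "granular f"
      using near_ge by (auto simp: granular_def f)
    have "f y \<noteq> 0" if "y \<in> set near \<union> set far" for y
      using that near_ge[of y] sqrt_c unfolding f by (smt (verit) Un_iff)
    moreover have "f y = 0" if "y \<notin> set near \<union> set far" for y
      using that by (simp add: f)
    ultimately have "{y\<in>pverts G. f y \<noteq> 0} = set near \<union> set far"
      using sub out_nbrs_subset[of x] by blast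
    then have "card {y\<in>pverts G. f y \<noteq> 0} = length near + length far"
      using dist by (simp add: card_Un_disjoint distinct_card)
    then show ?thesis
      using k \<open>granular f\<close> by simp
  qed
  then show "granular f" "card {y\<in>pverts G. f y \<noteq> 0} \<le> k" "k \<le> 3 + card {y\<in>pverts G. f y \<noteq> 0}"
    by auto
qed

text \<open>A near neighbour receives \<open>a / d_in\<close> outright. A far one receives
  \<open>1 - sqrt c\<close> with probability at most \<open>a / ((1 - sqrt c) * d_in)\<close>, again
  at most \<open>a / d_in\<close> in the mean. The coin contributes \<open>sqrt c\<close>.\<close>

lemma expected_vbbw_node:
  assumes x: "x \<in> pverts G" and a: "0 \<le> a"
  shows "(\<integral>\<^sup>+ r. ennreal (fst r y) \<partial>vbbw_node G adj c x a)
    \<le> (if x \<in> in_nbrs G y then ennreal (sqrt c / real (d_in G y)) * ennreal a else 0)"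
proof -
  define P where "P = (\<lambda>y. real (d_in G y) \<le> a / (1 - sqrt c))"
  define near where "near = takeWhile P (adj x)"
  define scan where "scan = random_scan G c a (dropWhile P (adj x))"
  let ?e = "\<integral>\<^sup>+ far. ennreal (if y \<in> set near then a / real (d_in G y)
                   else if y \<in> set far then 1 - sqrt c else 0) \<partial>scan"
  have eq: "(\<integral>\<^sup>+ r. ennreal (fst r y) \<partial>vbbw_node G adj c x a) = ?e * ennreal (sqrt c)"
    using sqrt_c by (simp add: vbbw_node_def P_def near_def scan_def Let_def)
  have out: "y \<in> set (adj x) \<longleftrightarrow> x \<in> in_nbrs G y"
    by (simp add: adj(2)[OF x] in_nbrs_def out_nbrs_def)
  have e: "?e \<le> (if x \<in> in_nbrs G y then ennreal (a / real (d_in G y)) else 0)"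
  proof (cases "y \<in> set near")
    case True
    then have "y \<in> set (adj x)"
      by (auto simp: near_def dest: set_takeWhileD)
    then show ?thesis
      using True out by simp
  next
    case False
    show ?thesis
    proof (cases "x \<in> in_nbrs G y")
      case True
      then have d: "0 < d_in G y"
        using d_in_pos[of y x] by (simp add: in_nbrs_def out_nbrs_def)
      have "?e = (\<integral>\<^sup>+ far. ennreal (1 - sqrt c) * indicator {far. y \<in> set far} far \<partial>scan)"
        using False by (intro nn_integral_cong) (auto simp: indicator_def)
      also have "\<dots> = ennreal (1 - sqrt c) * emeasure (measure_pmf scan) {far. y \<in> set far}"
        by (subst nn_integral_cmult_indicator) auto
      also have "\<dots> \<le> ennreal (1 - sqrt c) * ennreal (a / ((1 - sqrt c) * real (d_in G y)))"
        unfolding scan_def using d a by (intro mult_left_mono emeasure_random_scan_le) auto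
      also have "\<dots> = ennreal (a / real (d_in G y))"
        using sqrt_c a d by (simp flip: ennreal_mult)
      finally show ?thesis
        using True by simp
    next
      case nin: False
      have "y \<notin> set far" if far: "far \<in> set_pmf scan" for far
      proof -
        obtain m where "far = take m (dropWhile P (adj x))"
          using in_set_random_scan[OF far[unfolded scan_def]] by auto
        then show ?thesis
          using nin out by (auto dest!: in_set_takeD set_dropWhileD)
      qed
      then have "?e = (\<integral>\<^sup>+ far. 0 \<partial>scan)"
        using False by (intro nn_integral_cong_AE) (auto simp: AE_measure_pmf_iff)
      then show ?thesis
        using nin by simp
    qed
  qed
  show ?thesis
    unfolding eq using mult_right_mono[OF e, of "ennreal (sqrt c)"] sqrt_c a
    by (auto simp flip: ennreal_mult split: if_splits simp: mult.commute)
qed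

text \<open>The time is at most 3 per nonzero entry of \<open>p\<close> plus the number of entries
  written. Granularity replaces both counts by masses; these are linear, so contributions of
  different nodes to the same target add up and expectations can be taken.\<close>

lemma set_vbbw_level:
  assumes p: "granular p" and pk: "(p', k) \<in> set_pmf (vbbw_level G adj c p)"
  shows "granular p'" "card {y\<in>pverts G. p' y \<noteq> 0} \<le> k"
    "real k \<le> 1 + 3 * R * (\<Sum>x\<in>pverts G. p x) + R * (\<Sum>y\<in>pverts G. p' y)"
proof -
  define F where "F = {x\<in>pverts G. p x \<noteq> 0}"
  have "finite F"
    using finite_pverts by (simp add: F_def)
  obtain f where f: "f \<in> set_pmf (Pi_pmf F (\<lambda>_. 0, 0) (\<lambda>x. vbbw_node G adj c x (p x)))"
    and p': "p' = (\<lambda>y. \<Sum>x\<in>F. fst (f x) y)" and k: "k = 1 + (\<Sum>x\<in>F. snd (f x))"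
    using pk by (auto simp: vbbw_level_def F_def Let_def)
  have "(fst (f x), snd (f x)) \<in> set_pmf (vbbw_node G adj c x (p x))" if "x \<in> F" for x
    using f that \<open>finite F\<close> by (auto simp: set_Pi_pmf PiE_dflt_def)
  moreover have "1 - sqrt c \<le> p x" "x \<in> pverts G" if "x \<in> F" for x
    using p that by (auto simp: F_def granular_def)
  ultimately have node: "granular (fst (f x))" "card {y\<in>pverts G. fst (f x) y \<noteq> 0} \<le> snd (f x)"
    "snd (f x) \<le> 3 + card {y\<in>pverts G. fst (f x) y \<noteq> 0}" if "x \<in> F" for x
    using set_vbbw_node that by blast+
  show "granular p'"
    unfolding p' by (intro granular_sum node)
  have snd_le: "real (snd (f x)) \<le> 3 + R * (\<Sum>y\<in>pverts G. fst (f x) y)" if "x \<in> F" for x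
    using node(3)[OF that] card_granular_le[OF node(1)[OF that]] by linarith
  have "real k \<le> 1 + (\<Sum>x\<in>F. 3 + R * (\<Sum>y\<in>pverts G. fst (f x) y))"
    unfolding k using snd_le by (simp add: sum_mono)
  also have "\<dots> = 1 + 3 * real (card F) + R * (\<Sum>y\<in>pverts G. p' y)"
    unfolding p' by (subst sum.swap) (simp add: sum.distrib sum_distrib_left)
  also have "\<dots> \<le> 1 + 3 * (R * (\<Sum>x\<in>pverts G. p x)) + R * (\<Sum>y\<in>pverts G. p' y)"
    using card_granular_le[OF p] by (simp add: F_def)
  finally show "real k \<le> 1 + 3 * R * (\<Sum>x\<in>pverts G. p x) + R * (\<Sum>y\<in>pverts G. p' y)"
    by simp
  have "{y\<in>pverts G. p' y \<noteq> 0} \<subseteq> (\<Union>x\<in>F. {y\<in>pverts G. fst (f x) y \<noteq> 0})"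
    unfolding p' by (auto intro: ccontr dest: sum.not_neutral_contains_not_neutral)
  then have "card {y\<in>pverts G. p' y \<noteq> 0} \<le> card (\<Union>x\<in>F. {y\<in>pverts G. fst (f x) y \<noteq> 0})"
    using \<open>finite F\<close> finite_pverts by (intro card_mono) auto
  also have "\<dots> \<le> (\<Sum>x\<in>F. card {y\<in>pverts G. fst (f x) y \<noteq> 0})"
    by (rule card_UN_le[OF \<open>finite F\<close>])
  also have "\<dots> \<le> k"
    unfolding k using node(2) by (intro trans_le_add2 sum_mono)
  finally show "card {y\<in>pverts G. p' y \<noteq> 0} \<le> k" .
qed

text \<open>Linearity of expectation reduces the product distribution to its marginals, one per
  node. The bound has the shape of the recursion \<open>term_prob_Suc\<close>.\<close>

lemma expected_vbbw_level:
  assumes p: "granular p"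
  shows "(\<integral>\<^sup>+ r. ennreal (fst r y) \<partial>vbbw_level G adj c p)
    \<le> ennreal (sqrt c / real (d_in G y)) * (\<Sum>x\<in>in_nbrs G y. ennreal (p x))"
proof -
  define F where "F = {x\<in>pverts G. p x \<noteq> 0}"
  have "finite F"
    using finite_pverts by (simp add: F_def)
  let ?\<Pi> = "Pi_pmf F (\<lambda>_. 0, 0) (\<lambda>x. vbbw_node G adj c x (p x))"
  have "(\<integral>\<^sup>+ r. ennreal (fst r y) \<partial>vbbw_level G adj c p)
      \<le> (\<integral>\<^sup>+ f. (\<Sum>x\<in>F. ennreal (fst (f x) y)) \<partial>?\<Pi>)"
    by (auto simp: vbbw_level_def F_def Let_def intro!: nn_integral_mono ennreal_sum_le)
  also have "\<dots> = (\<Sum>x\<in>F. \<integral>\<^sup>+ f. ennreal (fst (f x) y) \<partial>?\<Pi>)"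
    by (simp add: nn_integral_sum)
  also have "\<dots> = (\<Sum>x\<in>F. \<integral>\<^sup>+ r. ennreal (fst r y) \<partial>map_pmf (\<lambda>f. f x) ?\<Pi>)"
    by simp
  also have "\<dots> = (\<Sum>x\<in>F. \<integral>\<^sup>+ r. ennreal (fst r y) \<partial>vbbw_node G adj c x (p x))"
    using \<open>finite F\<close> by (intro sum.cong) (simp_all only: Pi_pmf_component if_True)
  also have "\<dots> \<le> (\<Sum>x\<in>F. if x \<in> in_nbrs G y
      then ennreal (sqrt c / real (d_in G y)) * ennreal (p x) else 0)"
    using p by (intro sum_mono expected_vbbw_node) (auto simp: F_def granular_nonneg)
  also have "\<dots> = (\<Sum>x\<in>F \<inter> in_nbrs G y. ennreal (sqrt c / real (d_in G y)) * ennreal (p x))"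
    using \<open>finite F\<close> by (simp add: sum.If_cases Int_def)
  also have "\<dots> \<le> (\<Sum>x\<in>in_nbrs G y. ennreal (sqrt c / real (d_in G y)) * ennreal (p x))"
    using finite_in_nbrs by (intro sum_mono2) auto
  finally show ?thesis
    by (simp add: sum_distrib_left)
qed

text \<open>Granularity passes from level to level. The bound on the number of entries lets the
  updates of \<open>s_B\<close> after a walk be charged to the time of the walk.\<close>

lemma set_vbbw:
  assumes "(p, k) \<in> set_pmf (vbbw G adj c w l)"
  shows "granular p" "card {y\<in>pverts G. p y \<noteq> 0} \<le> k"
proof -
  have "granular p \<and> card {y\<in>pverts G. p y \<noteq> 0} \<le> k"
    using assms
  proof (induction l arbitrary: p k)
    case 0
    have "card {y\<in>pverts G. p y \<noteq> 0} \<le> card {w}"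
      using 0 by (intro card_mono) (auto split: if_splits)
    then show ?case
      using 0 by (auto simp: granular_def)
  next
    case (Suc l)
    then obtain q j k' where "(q, j) \<in> set_pmf (vbbw G adj c w l)"
      "(p, k') \<in> set_pmf (vbbw_level G adj c q)" "k = j + k'"
      by auto
    then show ?case
      using Suc.IH[of q j] set_vbbw_level[of q p k'] by auto
  qed
  then show "granular p" "card {y\<in>pverts G. p y \<noteq> 0} \<le> k"
    by auto
qed

lemma expected_vbbw_Suc:
  "(\<integral>\<^sup>+ r. f (fst r) \<partial>vbbw G adj c w (Suc l))
    = (\<integral>\<^sup>+ r. (\<integral>\<^sup>+ r'. f (fst r') \<partial>vbbw_level G adj c (fst r)) \<partial>vbbw G adj c w l)"
  by (simp add: case_prod_beta')

text \<open>Conditioning on the previous level turns the one-level bound into the recursion of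
  \<open>term_prob\<close>. Of unbiasedness only this direction enters the cost.\<close>

lemma expected_vbbw_value:
  "(\<integral>\<^sup>+ r. ennreal (fst r y) \<partial>vbbw G adj c w l) \<le> ennreal (term_prob G c l y w)"
proof (induction l arbitrary: y)
  case (Suc l)
  have "(\<integral>\<^sup>+ r. ennreal (fst r y) \<partial>vbbw G adj c w (Suc l))
      \<le> (\<integral>\<^sup>+ r. ennreal (sqrt c / real (d_in G y)) * (\<Sum>x\<in>in_nbrs G y. ennreal (fst r x))
          \<partial>vbbw G adj c w l)"
    unfolding expected_vbbw_Suc[where f = "\<lambda>p. ennreal (p y)"]
    by (intro nn_integral_mono_AE)
      (auto simp: AE_measure_pmf_iff intro!: expected_vbbw_level set_vbbw)
  also have "\<dots> = ennreal (sqrt c / real (d_in G y)) *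
      (\<Sum>x\<in>in_nbrs G y. \<integral>\<^sup>+ r. ennreal (fst r x) \<partial>vbbw G adj c w l)"
    by (simp add: nn_integral_cmult nn_integral_sum)
  also have "\<dots> \<le> ennreal (sqrt c / real (d_in G y)) *
      (\<Sum>x\<in>in_nbrs G y. ennreal (term_prob G c l x w))"
    by (intro mult_left_mono sum_mono Suc.IH) auto
  also have "\<dots> = ennreal (term_prob G c (Suc l) y w)"
    using sqrt_c by (simp add: term_prob_Suc sum_nonneg term_prob_nonneg flip: ennreal_mult)
  finally show ?case .
qed (use sqrt_c in \<open>simp add: term_prob_0\<close>)

lemma expected_vbbw_mass:
  "(\<integral>\<^sup>+ r. ennreal (\<Sum>y\<in>pverts G. fst r y) \<partial>vbbw G adj c w l)
    \<le> ennreal (\<Sum>y\<in>pverts G. term_prob G c l y w)"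
proof -
  have "(\<integral>\<^sup>+ r. ennreal (\<Sum>y\<in>pverts G. fst r y) \<partial>vbbw G adj c w l)
      \<le> (\<integral>\<^sup>+ r. (\<Sum>y\<in>pverts G. ennreal (fst r y)) \<partial>vbbw G adj c w l)"
    by (intro nn_integral_mono ennreal_sum_le)
  also have "\<dots> = (\<Sum>y\<in>pverts G. \<integral>\<^sup>+ r. ennreal (fst r y) \<partial>vbbw G adj c w l)"
    by (simp add: nn_integral_sum)
  also have "\<dots> \<le> (\<Sum>y\<in>pverts G. ennreal (term_prob G c l y w))"
    by (intro sum_mono expected_vbbw_value)
  finally show ?thesis
    by (simp add: term_prob_nonneg)
qed

text \<open>A level costs one unit, \<open>3 * R\<close> times the mass it starts from and
  \<open>R\<close> times the mass it produces; hence the two sums, shifted by one level.\<close>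

lemma expected_vbbw_time:
  "(\<integral>\<^sup>+ r. of_nat (snd r) \<partial>vbbw G adj c w l)
    \<le> ennreal (1 + real l + 3 * R * (\<Sum>i<l. \<Sum>y\<in>pverts G. term_prob G c i y w)
        + R * (\<Sum>i\<le>l. \<Sum>y\<in>pverts G. term_prob G c i y w))"
proof (induction l)
  case 0
  have "0 \<le> R * (\<Sum>y\<in>pverts G. term_prob G c 0 y w)"
    using R_pos by (intro mult_nonneg_nonneg sum_nonneg term_prob_nonneg) auto
  then show ?case
    by simp
next
  case (Suc l)
  let ?m = "\<lambda>p. \<Sum>y\<in>pverts G. p y"
  let ?M = "\<lambda>i. \<Sum>y\<in>pverts G. term_prob G c i y w"
  have M: "0 \<le> ?M i" for i
    by (intro sum_nonneg term_prob_nonneg)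
  have le: "of_nat k' \<le> 1 + (ennreal (3 * R) * ennreal (?m p) + ennreal R * ennreal (?m p'))"
    if "(p, k) \<in> set_pmf (vbbw G adj c w l)" "(p', k') \<in> set_pmf (vbbw_level G adj c p)" for p k p' k'
  proof -
    have p: "granular p"
      using that set_vbbw by blast
    have nn: "0 \<le> ?m p" "0 \<le> ?m p'"
      using granular_nonneg[OF p] granular_nonneg[OF set_vbbw_level(1)[OF p that(2)]]
      by (auto intro!: sum_nonneg)
    have "ennreal (real k') \<le> ennreal (1 + 3 * R * ?m p + R * ?m p')"
      using set_vbbw_level(3)[OF p that(2)] by (rule ennreal_leI)
    then show ?thesis
      using nn R_pos by (simp add: ennreal_plus ennreal_mult ennreal_of_nat_eq_real_of_nat add.assoc)
  qed
  have "(\<integral>\<^sup>+ r. of_nat (snd r) \<partial>vbbw G adj c w (Suc l))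
      = (\<integral>\<^sup>+ r. (\<integral>\<^sup>+ r'. of_nat (snd r + snd r') \<partial>vbbw_level G adj c (fst r)) \<partial>vbbw G adj c w l)"
    by (simp add: case_prod_beta')
  also have "\<dots> \<le> (\<integral>\<^sup>+ r. (\<integral>\<^sup>+ r'. of_nat (snd r) + (1 + ennreal (3 * R) * ennreal (?m (fst r))
      + ennreal R * ennreal (?m (fst r'))) \<partial>vbbw_level G adj c (fst r)) \<partial>vbbw G adj c w l)"
    by (intro nn_integral_mono_AE) (auto simp: AE_measure_pmf_iff intro!: nn_integral_mono_AE le)
  also have "\<dots> = (\<integral>\<^sup>+ r. of_nat (snd r) \<partial>vbbw G adj c w l) +
      (1 + ennreal (3 * R) * (\<integral>\<^sup>+ r. ennreal (?m (fst r)) \<partial>vbbw G adj c w l)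
      + ennreal R * (\<integral>\<^sup>+ r. ennreal (?m (fst r)) \<partial>vbbw G adj c w (Suc l)))"
    unfolding expected_vbbw_Suc[where f = "\<lambda>p. ennreal (?m p)"]
    by (simp add: nn_integral_add nn_integral_cmult del: vbbw.simps)
  also have "\<dots> \<le> ennreal (1 + real l + 3 * R * (\<Sum>i<l. ?M i) + R * (\<Sum>i\<le>l. ?M i)) +
      (1 + ennreal (3 * R) * ennreal (?M l) + ennreal R * ennreal (?M (Suc l)))"
    by (intro add_mono mult_left_mono Suc.IH expected_vbbw_mass) auto
  also have "\<dots> = ennreal (1 + real l + 3 * R * (\<Sum>i<l. ?M i) + R * (\<Sum>i\<le>l. ?M i)
      + (1 + 3 * R * ?M l + R * ?M (Suc l)))"
    using R_pos by (simp add: ennreal_plus ennreal_mult M sum_nonneg)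
  also have "\<dots> = ennreal (1 + real (Suc l) + 3 * R * (\<Sum>i<Suc l. ?M i) + R * (\<Sum>i\<le>Suc l. ?M i))"
    by (intro arg_cong[of _ _ ennreal]) (simp add: algebra_simps)
  finally show ?case .
qed

text \<open>Both sums over levels are at most \<open>n_pagerank w\<close>, and 3 + 1 = 4. The
  summand \<open>Suc l\<close> is the number of nodes of the walk that selected level
  \<open>l\<close> and will be charged to it.\<close>

lemma expected_vbbw_time_le:
  "(\<integral>\<^sup>+ r. of_nat (snd r) \<partial>vbbw G adj c w l) \<le> of_nat (Suc l) + ennreal (4 * R * n_pagerank w)"
proof -
  let ?M = "\<lambda>i. \<Sum>y\<in>pverts G. term_prob G c i y w"
  have "(\<Sum>i<l. ?M i) \<le> (\<Sum>i\<le>l. ?M i)"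
    by (intro sum_mono2) (auto intro: sum_nonneg term_prob_nonneg)
  then have "3 * R * (\<Sum>i<l. ?M i) \<le> 3 * R * n_pagerank w" "R * (\<Sum>i\<le>l. ?M i) \<le> R * n_pagerank w"
    using R_pos sum_term_prob_le_n_pagerank[where w = w and l = l]
    by (auto intro!: mult_left_mono)
  then have "1 + real l + 3 * R * (\<Sum>i<l. ?M i) + R * (\<Sum>i\<le>l. ?M i)
      \<le> real (Suc l) + 4 * R * n_pagerank w"
    by simp
  then have "(\<integral>\<^sup>+ r. of_nat (snd r) \<partial>vbbw G adj c w l) \<le> ennreal (real (Suc l) + 4 * R * n_pagerank w)"
    using expected_vbbw_time ennreal_leI order_trans by blast
  then show ?thesis
    using R_pos n_pagerank_nonneg by (simp add: ennreal_plus ennreal_of_nat_eq_real_of_nat)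
qed

section \<open>The cost of a query\<close>

text \<open>All pairs are charged in proportion to their estimators, so that a sample raises the
  bound by an amount independent of the current state. The counting measure makes the sum meaningful
  for arbitrary estimators.\<close>

definition read_bound :: "real \<Rightarrow> (nat \<Rightarrow> 'a \<Rightarrow> real) \<Rightarrow> ennreal" where
  "read_bound \<epsilon> e = (\<integral>\<^sup>+ (w, l). ennreal (e l w) *
     (ennreal (c1 c / \<epsilon>) * of_nat (card (index_list G c \<epsilon> w l))) \<partial>count_space UNIV)"

text \<open>
  The last two terms are doubled because \<open>finish\<close> outputs at most as many nodes as it reads tuples
  and selects medians from nonzero entries.
\<close>
definition potential :: "real \<Rightarrow> nat \<Rightarrow> 'a query_state \<Rightarrow> ennreal" where
  "potential \<epsilon> f_r s = of_nat (time s) + of_nat (card {(w, l). eta_pi s l w \<noteq> 0})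
     + 2 * read_bound \<epsilon> (eta_pi s)
     + 2 * (\<Sum>i\<in>{1..f_r}. of_nat (card {v\<in>pverts G. s_B s i v \<noteq> 0}))"

lemma potential_time:
  "potential \<epsilon> f_r (s\<lparr>time := time s + k\<rparr>) = potential \<epsilon> f_r s + of_nat k"
  by (simp add: potential_def add_ac)

lemma c1_pos: "0 < c1 c"
  using sqrt_c by (simp add: c1_def)

text \<open>
  Markov's inequality holds pathwise: an index list is read only if its estimator exceeds
  \<open>\<epsilon> / c1 c\<close>.
\<close>
lemma read_le:
  assumes "0 < \<epsilon>"
  shows "of_nat (\<Sum>(w, l)\<in>{(w, l). w \<in> hubs \<and> e l w > \<epsilon> / c1 c}. card (index_list G c \<epsilon> w l))
    \<le> read_bound \<epsilon> e"
proof -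
  define S where "S = {(w, l). w \<in> hubs \<and> e l w > \<epsilon> / c1 c}"
  let ?L = "\<lambda>w l. of_nat (card (index_list G c \<epsilon> w l)) :: ennreal"
  let ?f = "\<lambda>(w, l). ennreal (e l w) * (ennreal (c1 c / \<epsilon>) * ?L w l)"
  have le: "(case x of (w, l) \<Rightarrow> ?L w l) \<le> ?f x" if "x \<in> S" for x
  proof -
    obtain w l where x: "x = (w, l)"
      by (cases x)
    have "1 \<le> e l w * (c1 c / \<epsilon>)"
      using that c1_pos assms by (auto simp: S_def x field_simps)
    then have "1 \<le> ennreal (e l w) * ennreal (c1 c / \<epsilon>)"
      using c1_pos assms by (subst ennreal_mult''[symmetric]) auto
    from mult_right_mono[OF this, of "?L w l"] show ?thesis
      by (simp add: x mult.assoc)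
  qed
  show ?thesis
  \<comment> \<open>The state is arbitrary, so \<open>S\<close> may be infinite; the sum over it is
    then 0 by convention.\<close>
  proof (cases "finite S")
    case True
    have "of_nat (\<Sum>(w, l)\<in>S. card (index_list G c \<epsilon> w l)) = (\<Sum>(w, l)\<in>S. ?L w l)"
      by (simp add: case_prod_beta')
    also have "\<dots> \<le> (\<Sum>x\<in>S. ?f x)"
      by (intro sum_mono le)
    also have "\<dots> = (\<integral>\<^sup>+ x. ?f x * indicator S x \<partial>count_space UNIV)"
      using True by (simp add: nn_integral_count_space_finite flip: nn_integral_count_space_indicator)
    also have "\<dots> \<le> (\<integral>\<^sup>+ x. ?f x \<partial>count_space UNIV)"
      by (intro nn_integral_mono) (auto simp: indicator_def)
    finally show ?thesis
      by (simp add: S_def read_bound_def)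
  qed (simp add: S_def)
qed

lemma finish_le:
  assumes "0 < \<epsilon>"
  shows "of_nat (snd (finish G c \<epsilon> hubs f_r s)) \<le> potential \<epsilon> f_r s"
proof -
  define touched where "touched = {v\<in>pverts G. \<exists>i\<in>{1..f_r}. s_B s i v \<noteq> 0}"
  define rd where "rd = {(w, l). w \<in> hubs \<and> eta_pi s l w > \<epsilon> / c1 c}"
  define sI where "sI = (\<lambda>v. \<Sum>(w, l)\<in>rd. \<Sum>(v', q)\<in>index_list G c \<epsilon> w l.
      if v' = v then eta_pi s l w * q / (1 - sqrt c)\<^sup>2 else 0)"
  define N where "N = (\<Sum>i\<in>{1..f_r}. card {v\<in>pverts G. s_B s i v \<noteq> 0})"
  define M where "M = (\<Sum>(w, l)\<in>rd. card (index_list G c \<epsilon> w l))"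
  have fin: "finite touched"
    using finite_pverts by (simp add: touched_def)
  \<comment> \<open>Double counting of the pairs of a node and a round with a nonzero
    estimate.\<close>
  have medians: "(\<Sum>v\<in>touched. card {i\<in>{1..f_r}. s_B s i v \<noteq> 0}) = N"
  proof -
    have "(\<Sum>v\<in>touched. card {i\<in>{1..f_r}. s_B s i v \<noteq> 0})
        = (\<Sum>i\<in>{1..f_r}. card {v\<in>touched. s_B s i v \<noteq> 0})"
      using fin by (intro sum_multicount_gen[symmetric, of _ _ "\<lambda>i v. s_B s i v \<noteq> 0"]) auto
    also have "\<dots> = N"
      unfolding N_def touched_def by (intro sum.cong refl arg_cong[of _ _ card]) auto
    finally show ?thesis .
  qed
  have "card touched = (\<Sum>v\<in>touched. 1)"
    by simp
  also have "\<dots> \<le> (\<Sum>v\<in>touched. card {i\<in>{1..f_r}. s_B s i v \<noteq> 0})"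
    by (intro sum_mono) (auto simp: touched_def Suc_le_eq card_gt_0_iff)
  finally have touched_le: "card touched \<le> N"
    unfolding medians .
  \<comment> \<open>A nonzero index estimate of \<open>v\<close> comes from at least one tuple for
    \<open>v\<close> that was read. For infinite \<open>rd\<close> the sum \<open>sI\<close> is 0 by
    convention.\<close>
  have sI_le: "card {v\<in>pverts G. sI v \<noteq> 0} \<le> M"
  proof (cases "finite rd")
    case True
    have "v \<in> (\<Union>(w, l)\<in>rd. fst ` index_list G c \<epsilon> w l)" if nz: "sI v \<noteq> 0" for v
    proof -
      obtain x where "x \<in> rd" "(case x of (w, l) \<Rightarrow> \<Sum>(v', q)\<in>index_list G c \<epsilon> w l.
          if v' = v then eta_pi s l w * q / (1 - sqrt c)\<^sup>2 else 0) \<noteq> 0"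
        by (rule sum.not_neutral_contains_not_neutral[OF nz[unfolded sI_def]])
      then obtain w l where wl: "(w, l) \<in> rd" and "(\<Sum>(v', q)\<in>index_list G c \<epsilon> w l.
          if v' = v then eta_pi s l w * q / (1 - sqrt c)\<^sup>2 else 0) \<noteq> 0"
        by (cases x) auto
      then obtain q where "(v, q) \<in> index_list G c \<epsilon> w l"
        by (auto elim!: sum.not_neutral_contains_not_neutral split: if_splits)
      then show ?thesis
        using wl by (force intro!: bexI[of _ "(w, l)"])
    qed
    then have "card {v\<in>pverts G. sI v \<noteq> 0} \<le> card (\<Union>(w, l)\<in>rd. fst ` index_list G c \<epsilon> w l)"
      using True finite_index_list by (intro card_mono) auto
    also have "\<dots> \<le> (\<Sum>(w, l)\<in>rd. card (fst ` index_list G c \<epsilon> w l))"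
      using card_UN_le[OF True, of "\<lambda>(w, l). fst ` index_list G c \<epsilon> w l"]
      by (simp add: case_prod_beta')
    also have "\<dots> \<le> M"
      unfolding M_def by (intro sum_mono) (auto intro: card_image_le finite_index_list)
    finally show ?thesis .
  qed (simp add: sI_def)
  have M_le: "of_nat M \<le> read_bound \<epsilon> (eta_pi s)"
    unfolding M_def rd_def by (rule read_le[OF assms])
  have "snd (finish G c \<epsilon> hubs f_r s) = time s + card {(w, l). eta_pi s l w \<noteq> 0} + M + N
      + card (touched \<union> {v\<in>pverts G. sI v \<noteq> 0})"
    unfolding finish_def Let_def medians[symmetric] touched_def M_def rd_def sI_def by simp
  also have "\<dots> \<le> time s + card {(w, l). eta_pi s l w \<noteq> 0} + 2 * M + 2 * N"
    using card_Un_le[of touched "{v\<in>pverts G. sI v \<noteq> 0}"] touched_le sI_le by simp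
  finally have "of_nat (snd (finish G c \<epsilon> hubs f_r s))
      \<le> (of_nat (time s + card {(w, l). eta_pi s l w \<noteq> 0} + 2 * M + 2 * N) :: ennreal)"
    by (simp only: of_nat_le_iff)
  also have "\<dots> = of_nat (time s) + of_nat (card {(w, l). eta_pi s l w \<noteq> 0}) + 2 * of_nat M + 2 * of_nat N"
    by simp
  also have "\<dots> \<le> potential \<epsilon> f_r s"
    unfolding potential_def N_def of_nat_sum by (intro add_mono mult_left_mono M_le) auto
  finally show ?thesis .
qed

text \<open>A bound on the growth of \<open>read_bound\<close> when the estimator of
  \<open>w\<close> at level \<open>l\<close> rises by \<open>h\<close>.\<close>

definition index_cost :: "real \<Rightarrow> real \<Rightarrow> 'a \<Rightarrow> nat \<Rightarrow> ennreal" where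
  "index_cost \<epsilon> h w l = ennreal h * (ennreal (c1 c / \<epsilon>) * of_nat (card (index_list G c \<epsilon> w l)))"

lemma read_bound_update:
  "read_bound \<epsilon> (e(l := (e l)(w := e l w + h))) \<le> read_bound \<epsilon> e + index_cost \<epsilon> h w l"
proof -
  let ?K = "\<lambda>(w, l). ennreal (c1 c / \<epsilon>) * of_nat (card (index_list G c \<epsilon> w l))"
  let ?g = "\<lambda>x. ennreal (e (snd x) (fst x)) * ?K x + index_cost \<epsilon> h w l * indicator {(w, l)} x"
  have le: "(case x of (v, m) \<Rightarrow> ennreal ((e(l := (e l)(w := e l w + h))) m v) *
      (ennreal (c1 c / \<epsilon>) * of_nat (card (index_list G c \<epsilon> v m)))) \<le> ?g x" for x
  proof -
    have "ennreal (e l w + h) * ?K (w, l) \<le> (ennreal (e l w) + ennreal h) * ?K (w, l)"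
      by (intro mult_right_mono ennreal_add_le) auto
    then show ?thesis
      by (cases x) (auto simp: index_cost_def distrib_right indicator_def)
  qed
  have "read_bound \<epsilon> (e(l := (e l)(w := e l w + h))) \<le> (\<integral>\<^sup>+ x. ?g x \<partial>count_space UNIV)"
    unfolding read_bound_def by (intro nn_integral_mono le)
  also have "\<dots> = read_bound \<epsilon> e + index_cost \<epsilon> h w l"
    by (simp add: nn_integral_add read_bound_def case_prod_beta' nn_integral_cmult_indicator
        nn_integral_cmult)
  finally show ?thesis .
qed

text \<open>The 2 pays for the update itself and for a possible new nonzero entry; the factor of
  \<open>index_cost\<close> is that of \<open>read_bound\<close> in the potential.\<close>

lemma potential_eta:
  "potential \<epsilon> f_r (s\<lparr>eta_pi := (eta_pi s)(l := (eta_pi s l)(w := eta_pi s l w + h)),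
      time := time s + 1\<rparr>)
    \<le> potential \<epsilon> f_r s + (2 + 2 * index_cost \<epsilon> h w l)"
proof -
  let ?e = "(eta_pi s)(l := (eta_pi s l)(w := eta_pi s l w + h))"
  let ?A = "\<lambda>e :: nat \<Rightarrow> 'a \<Rightarrow> real. {(w, l). e l w \<noteq> 0}"
  have "card (?A ?e) \<le> Suc (card (?A (eta_pi s)))"
  proof (cases "finite (?A (eta_pi s))")
    case True
    have "card (?A ?e) \<le> card (insert (w, l) (?A (eta_pi s)))"
      using True by (intro card_mono) (auto split: if_splits)
    also have "\<dots> \<le> Suc (card (?A (eta_pi s)))"
      by (rule card_insert_le_m1) auto
    finally show ?thesis .
  next
    \<comment> \<open>An infinite set has \<open>card\<close> 0, so the updated set has to be
      infinite as well. It is, since only one pair changes.\<close>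
    case False
    have "?A (eta_pi s) \<subseteq> insert (w, l) (?A ?e)"
      by auto
    then have "infinite (insert (w, l) (?A ?e))"
      using False finite_subset by blast
    then have "infinite (?A ?e)"
      by (simp only: finite_insert simp_thms)
    then show ?thesis
      by simp
  qed
  then have card_le: "of_nat (card (?A ?e)) \<le> (of_nat (card (?A (eta_pi s))) + 1 :: ennreal)"
    by (metis of_nat_Suc of_nat_le_iff add.commute)
  have sel: "time (s\<lparr>eta_pi := ?e, time := time s + 1\<rparr>) = time s + 1"
    "eta_pi (s\<lparr>eta_pi := ?e, time := time s + 1\<rparr>) = ?e"
    "s_B (s\<lparr>eta_pi := ?e, time := time s + 1\<rparr>) = s_B s"
    by simp_all
  have "potential \<epsilon> f_r (s\<lparr>eta_pi := ?e, time := time s + 1\<rparr>)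
      \<le> of_nat (time s + 1) + (of_nat (card (?A (eta_pi s))) + 1)
        + 2 * (read_bound \<epsilon> (eta_pi s) + index_cost \<epsilon> h w l)
        + 2 * (\<Sum>i\<in>{1..f_r}. of_nat (card {v\<in>pverts G. s_B s i v \<noteq> 0}))"
    unfolding potential_def sel by (intro add_mono mult_left_mono card_le read_bound_update) auto
  also have "\<dots> = potential \<epsilon> f_r s + (2 + 2 * index_cost \<epsilon> h w l)"
    unfolding potential_def of_nat_add of_nat_1
    by (simp only: numeral_Bit0 numeral_Bit1 numeral_One distrib_left distrib_right
        mult_1_left mult_1_right add_ac)
  finally show ?thesis .
qed

text \<open>The walk takes \<open>k\<close>, adding its entries takes at most \<open>k\<close>, and
  at most \<open>k\<close> new nonzero entries count twice: together \<open>4 * k\<close>.\<close>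

lemma potential_s_B:
  assumes "card {v\<in>pverts G. p v \<noteq> 0} \<le> k"
  shows "potential \<epsilon> f_r (s\<lparr>s_B := (s_B s)(i := (\<lambda>v. s_B s i v + p v / q)),
      time := time s + k + card {v\<in>pverts G. p v \<noteq> 0}\<rparr>)
    \<le> potential \<epsilon> f_r s + 4 * of_nat k"
proof -
  let ?n = "card {v\<in>pverts G. p v \<noteq> 0}"
  let ?A = "\<lambda>f. {v\<in>pverts G. f v \<noteq> 0}"
  let ?b = "(s_B s)(i := (\<lambda>v. s_B s i v + p v / q))"
  have "card (?A (?b j)) \<le> card (?A (s_B s j)) + (if j = i then k else 0)" for j
  proof (cases "j = i")
    case True
    have "card (?A (?b i)) \<le> card (?A (s_B s i) \<union> ?A p)"
      using finite_pverts by (intro card_mono) auto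
    also have "\<dots> \<le> card (?A (s_B s i)) + card (?A p)"
      by (rule card_Un_le)
    finally show ?thesis
      using True assms by simp
  qed simp
  then have "(\<Sum>j\<in>{1..f_r}. card (?A (?b j)))
      \<le> (\<Sum>j\<in>{1..f_r}. card (?A (s_B s j)) + (if j = i then k else 0))"
    by (intro sum_mono)
  also have "\<dots> \<le> (\<Sum>j\<in>{1..f_r}. card (?A (s_B s j))) + k"
    by (simp add: sum.distrib)
  finally have "time s + k + ?n + 2 * (\<Sum>j\<in>{1..f_r}. card (?A (?b j)))
      \<le> time s + 2 * (\<Sum>j\<in>{1..f_r}. card (?A (s_B s j))) + 4 * k"
    using assms by simp
  then have "of_nat (time s + k + ?n + 2 * (\<Sum>j\<in>{1..f_r}. card (?A (?b j))))
      \<le> (of_nat (time s + 2 * (\<Sum>j\<in>{1..f_r}. card (?A (s_B s j))) + 4 * k) :: ennreal)"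
    by (simp only: of_nat_le_iff)
  then have "of_nat (time s + k + ?n) + 2 * (\<Sum>j\<in>{1..f_r}. of_nat (card (?A (?b j))))
      \<le> (of_nat (time s) + 2 * (\<Sum>j\<in>{1..f_r}. of_nat (card (?A (s_B s j)))) + 4 * of_nat k :: ennreal)"
    by (simp only: of_nat_add of_nat_mult of_nat_sum of_nat_numeral)
  from add_right_mono[OF this, of "of_nat (card {(w, l). eta_pi s l w \<noteq> 0}) + 2 * read_bound \<epsilon> (eta_pi s)"]
  show ?thesis
    by (simp add: potential_def add_ac)
qed

section \<open>The expected cost of one sample and of the whole query\<close>

lemma expected_length_add:
  "nn_expect b (sqrt_walk G c u) (\<lambda>(_, xs). B + of_nat (length xs)) \<le> B + ennreal R"
  using nn_expect_walk_add_const[of b u "\<lambda>(_, xs). of_nat (length xs)" B] expected_walk_length[of b u]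
  by (simp add: case_prod_beta' add.commute add_left_mono)

text \<open>One factor \<open>c1 c / \<epsilon>\<close> stems from the reading threshold, the other
  from the length of the list.\<close>

lemma index_cost_le:
  assumes "0 < \<epsilon>" "0 \<le> h"
  shows "index_cost \<epsilon> h w l \<le> ennreal (h * (c1 c / \<epsilon>)\<^sup>2 * n_pagerank w)"
proof -
  have "ennreal (real (card (index_list G c \<epsilon> w l))) \<le> ennreal (c1 c / \<epsilon> * n_pagerank w)"
    by (intro ennreal_leI card_index_list assms)
  then have "index_cost \<epsilon> h w l \<le> ennreal h * (ennreal (c1 c / \<epsilon>) * ennreal (c1 c / \<epsilon> * n_pagerank w))"
    unfolding index_cost_def by (intro mult_left_mono) (auto simp: ennreal_of_nat_eq_real_of_nat)
  also have "\<dots> = ennreal (h * (c1 c / \<epsilon>)\<^sup>2 * n_pagerank w)"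
    using assms c1_pos n_pagerank_nonneg[of w]
    by (simp add: power2_eq_square mult.assoc flip: ennreal_mult)
  finally show ?thesis .
qed

text \<open>Of \<open>7 * R\<close>, the sampled walk accounts for \<open>5 * R\<close> (one unit
  per node, and four for the levels of the backward walk) and the two test walks for
  \<open>2 * R\<close>; the 2 is from \<open>potential_eta\<close>. The factor \<open>16 * R\<close>
  is 4 from \<open>potential_s_B\<close> times \<open>4 * R\<close> from
  \<open>expected_vbbw_time_le\<close>.\<close>

definition sample_cost :: "real \<Rightarrow> real \<Rightarrow> 'a \<Rightarrow> ennreal" where
  "sample_cost \<epsilon> h u = ennreal (7 * R + 2) + (\<Sum>w\<in>pverts G. ennreal (total_term_prob u w) *
     ennreal ((2 * h * (c1 c / \<epsilon>)\<^sup>2 + 16 * R) * n_pagerank w))"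

text \<open>Whatever the meeting test and the hub test decide, the cost is bounded by that of
  raising the estimator and running the backward walk. The free constant \<open>B\<close> fits the
  rule for loops.\<close>

lemma expected_sample_step:
  fixes d_r f_r :: nat
  assumes u: "u \<in> pverts G" and eps: "0 < \<epsilon>"
  defines "h \<equiv> 1 / (real d_r * real f_r)"
  shows "nn_expect \<infinity> (sample_step G adj c hubs d_r f_r u i s) (\<lambda>s. potential \<epsilon> f_r s + B)
    \<le> potential \<epsilon> f_r s + sample_cost \<epsilon> h u + B"
proof -
  define \<Phi> where "\<Phi> = (\<lambda>s. potential \<epsilon> f_r s + B)"
  define g where "g = (\<lambda>w. ennreal ((2 * h * (c1 c / \<epsilon>)\<^sup>2 + 16 * R) * n_pagerank w))"
  have h: "0 \<le> h"
    by (simp add: h_def)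
  have \<Phi>_time: "\<Phi> (s\<lparr>time := time s + k\<rparr>) = \<Phi> s + of_nat k" for s k
    unfolding \<Phi>_def potential_time by (simp add: add_ac)
  have vbbw: "(\<integral>\<^sup>+ (p, k). \<Phi> (s\<lparr>s_B := (s_B s)(i := (\<lambda>v. s_B s i v + p v / q)),
        time := time s + k + card {v\<in>pverts G. p v \<noteq> 0}\<rparr>) \<partial>vbbw G adj c w l)
      \<le> \<Phi> s + 4 * (\<integral>\<^sup>+ r. of_nat (snd r) \<partial>vbbw G adj c w l)" for s w l q
  proof -
    have "(\<integral>\<^sup>+ (p, k). \<Phi> (s\<lparr>s_B := (s_B s)(i := (\<lambda>v. s_B s i v + p v / q)),
        time := time s + k + card {v\<in>pverts G. p v \<noteq> 0}\<rparr>) \<partial>vbbw G adj c w l)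
      \<le> (\<integral>\<^sup>+ r. \<Phi> s + 4 * of_nat (snd r) \<partial>vbbw G adj c w l)"
    proof (intro nn_integral_mono_AE, unfold AE_measure_pmf_iff, clarify)
      fix p k assume "(p, k) \<in> set_pmf (vbbw G adj c w l)"
      from potential_s_B[OF set_vbbw(2)[OF this], THEN add_right_mono, of \<epsilon> f_r s i q B]
      show "\<Phi> (s\<lparr>s_B := (s_B s)(i := (\<lambda>v. s_B s i v + p v / q)),
          time := time s + k + card {v\<in>pverts G. p v \<noteq> 0}\<rparr>) \<le> \<Phi> s + 4 * of_nat (snd (p, k))"
        by (simp add: \<Phi>_def add_ac)
    qed
    also have "\<dots> = \<Phi> s + 4 * (\<integral>\<^sup>+ r. of_nat (snd r) \<partial>vbbw G adj c w l)"
      by (simp add: nn_integral_add nn_integral_cmult)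
    finally show ?thesis .
  qed
  define cont where "cont = (\<lambda>(t, xs). let s1 = s\<lparr>time := time s + length xs\<rparr>; w = last xs; l = length xs - 1 in
       if \<not> t then return_spmf s1
       else
         bind_spmf (sqrt_walk G c w) (\<lambda>(_, ys).
         bind_spmf (sqrt_walk G c w) (\<lambda>(_, zs).
           let s2 = s1\<lparr>time := time s1 + length ys + length zs\<rparr> in
           if meet_later ys zs then return_spmf s2
           else
             let s3 = s2\<lparr>eta_pi := (eta_pi s2)(l := (eta_pi s2 l)
                            (w := eta_pi s2 l w + 1 / (real d_r * real f_r))),
                         time := time s2 + 1\<rparr> in
             if w \<in> hubs then return_spmf s3
             else
               map_spmf (\<lambda>(p, k). s3
                   \<lparr>s_B := (s_B s3)(i := (\<lambda>v. s_B s3 i v + p v / ((1 - sqrt c)\<^sup>2 * real d_r))),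
                    time := time s3 + k + card {v\<in>pverts G. p v \<noteq> 0}\<rparr>)
                 (spmf_of_pmf (vbbw G adj c w l)))))"
  have cont: "nn_expect \<infinity> (cont (t, xs)) \<Phi>
      \<le> \<Phi> s + ennreal (2 * R + 2) + 5 * of_nat (length xs) + (if t then g (last xs) else 0)"
    if "xs \<noteq> []" for t xs
  proof (cases t)
    case False
    have "of_nat (length xs) \<le> (5 * of_nat (length xs) :: ennreal)"
      using mult_right_mono[of 1 5 "of_nat (length xs) :: ennreal"] by simp
    then have "\<Phi> s + of_nat (length xs) \<le> \<Phi> s + ennreal (2 * R + 2) + 5 * of_nat (length xs)"
      by (intro add_mono) auto
    then show ?thesis
      using False by (simp add: cont_def Let_def \<Phi>_time)
  next
    case True
    define w l where "w = last xs" and "l = length xs - 1"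
    define V where "V = (\<integral>\<^sup>+ r. of_nat (snd r) \<partial>vbbw G adj c w l)"
    define A where "A = \<Phi> s + of_nat (length xs) + (2 + 2 * index_cost \<epsilon> h w l) + 4 * V"
    define s1 where "s1 = s\<lparr>time := time s + length xs\<rparr>"
    define fin where "fin = (\<lambda>(ys :: 'a list) (zs :: 'a list). let s2 = s1\<lparr>time := time s1 + length ys + length zs\<rparr> in
           if meet_later ys zs then return_spmf s2
           else
             let s3 = s2\<lparr>eta_pi := (eta_pi s2)(l := (eta_pi s2 l)(w := eta_pi s2 l w + h)),
                         time := time s2 + 1\<rparr> in
             if w \<in> hubs then return_spmf s3
             else
               map_spmf (\<lambda>(p, k). s3
                   \<lparr>s_B := (s_B s3)(i := (\<lambda>v. s_B s3 i v + p v / ((1 - sqrt c)\<^sup>2 * real d_r))),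
                    time := time s3 + k + card {v\<in>pverts G. p v \<noteq> 0}\<rparr>)
                 (spmf_of_pmf (vbbw G adj c w l)))"
    have fin: "nn_expect \<infinity> (fin ys zs) \<Phi> \<le> A + of_nat (length ys) + of_nat (length zs)" for ys zs
    proof -
      define s2 where "s2 = s1\<lparr>time := time s1 + length ys + length zs\<rparr>"
      define s3 where "s3 = s2\<lparr>eta_pi := (eta_pi s2)(l := (eta_pi s2 l)(w := eta_pi s2 l w + h)),
                         time := time s2 + 1\<rparr>"
      have s2: "\<Phi> s2 = \<Phi> s + of_nat (length xs) + of_nat (length ys) + of_nat (length zs)"
        unfolding s2_def s1_def add.assoc \<Phi>_time by (simp add: add_ac)
      have s3: "\<Phi> s3 \<le> \<Phi> s2 + (2 + 2 * index_cost \<epsilon> h w l)"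
        using potential_eta[of \<epsilon> f_r s2 l w h, THEN add_right_mono, of B]
        by (simp add: \<Phi>_def s3_def add_ac)
      have A: "A + of_nat (length ys) + of_nat (length zs) = \<Phi> s2 + (2 + 2 * index_cost \<epsilon> h w l) + 4 * V"
        by (simp add: A_def s2 add_ac)
      \<comment> \<open>\<open>\<Phi> s2\<close> covers walks that meet,
        \<open>\<Phi> s3 + 4 * V\<close> the other two branches.\<close>
      have "nn_expect \<infinity> (fin ys zs) \<Phi> \<le> max (\<Phi> s2) (\<Phi> s3 + 4 * V)"
        unfolding fin_def Let_def s2_def[symmetric] s3_def[symmetric]
        using vbbw[where s = s3 and q = "(1 - sqrt c)\<^sup>2 * real d_r" and w = w and l = l]
        by (auto simp: nn_expect_map nn_expect_spmf_of_pmf case_prod_beta' V_def le_max_iff_disj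
            simp del: map_spmf_of_pmf)
      also have "\<dots> \<le> A + of_nat (length ys) + of_nat (length zs)"
        unfolding A using s3 by (auto intro: add_right_mono simp: add.assoc)
      finally show ?thesis .
    qed
    have "cont (t, xs) = bind_spmf (sqrt_walk G c w) (\<lambda>(_, ys).
        bind_spmf (sqrt_walk G c w) (\<lambda>(_, zs). fin ys zs))"
      using True unfolding cont_def fin_def w_def l_def s1_def h_def Let_def
      by (simp only: prod.case not_True_eq_False if_False)
    then have "nn_expect \<infinity> (cont (t, xs)) \<Phi> = nn_expect \<infinity> (sqrt_walk G c w)
        (\<lambda>(_, ys). nn_expect \<infinity> (sqrt_walk G c w) (\<lambda>(_, zs). nn_expect \<infinity> (fin ys zs) \<Phi>))"
      by (simp add: nn_expect_bind case_prod_beta')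
    also have "\<dots> \<le> nn_expect \<infinity> (sqrt_walk G c w)
        (\<lambda>(_, ys). nn_expect \<infinity> (sqrt_walk G c w) (\<lambda>(_, zs). A + of_nat (length ys) + of_nat (length zs)))"
      using fin by (auto intro!: nn_expect_mono)
    also have "\<dots> \<le> nn_expect \<infinity> (sqrt_walk G c w) (\<lambda>(_, ys). (A + ennreal R) + of_nat (length ys))"
    proof -
      have "nn_expect \<infinity> (sqrt_walk G c w) (\<lambda>(_, zs). A + of_nat (length ys) + of_nat (length zs))
          \<le> A + ennreal R + of_nat (length ys)" for ys :: "'a list"
        using expected_length_add[of \<infinity> w "A + of_nat (length ys)"] by (simp add: add_ac)
      then show ?thesis
        by (auto intro!: nn_expect_mono)
    qed
    also have "\<dots> \<le> A + ennreal R + ennreal R"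
      by (rule expected_length_add)
    \<comment> \<open>As \<open>xs\<close> is nonempty, \<open>Suc l\<close> is
      \<open>length xs\<close>, so the level-dependent time of the backward walk is charged to the
      nodes of the first walk.\<close>
    also have "\<dots> \<le> \<Phi> s + of_nat (length xs) + (2 + 2 * ennreal (h * (c1 c / \<epsilon>)\<^sup>2 * n_pagerank w))
        + 4 * (of_nat (length xs) + ennreal (4 * R * n_pagerank w)) + ennreal R + ennreal R"
      using expected_vbbw_time_le[of w l] that eps h
      unfolding A_def V_def l_def
      by (intro add_mono mult_left_mono index_cost_le) (auto simp del: of_nat_Suc)
    also have "\<dots> = \<Phi> s + ennreal (2 * R + 2) + 5 * of_nat (length xs) + g w"
    proof -
      have "g w = ennreal (2 * (h * (c1 c / \<epsilon>)\<^sup>2 * n_pagerank w) + 4 * (4 * R * n_pagerank w))"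
        unfolding g_def by (intro arg_cong[of _ _ ennreal]) algebra
      also have "\<dots> = ennreal (2 * (h * (c1 c / \<epsilon>)\<^sup>2 * n_pagerank w)) + ennreal (4 * (4 * R * n_pagerank w))"
        using h R_pos n_pagerank_nonneg[of w] by (intro ennreal_plus) auto
      also have "\<dots> = 2 * ennreal (h * (c1 c / \<epsilon>)\<^sup>2 * n_pagerank w) + 4 * ennreal (4 * R * n_pagerank w)"
        using h R_pos n_pagerank_nonneg[of w] by (simp only: ennreal_mult' ennreal_numeral zero_le_numeral)
      finally have g: "g w = 2 * ennreal (h * (c1 c / \<epsilon>)\<^sup>2 * n_pagerank w)
          + 4 * ennreal (4 * R * n_pagerank w)" .
      have R: "ennreal (2 * R + 2) = 2 * ennreal R + 2"
        using R_pos by (simp add: ennreal_plus ennreal_mult)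
      show ?thesis
        unfolding g R
        by (simp only: numeral_Bit0 numeral_Bit1 numeral_One distrib_left distrib_right
        mult_1_left mult_1_right add_ac)
    qed
    finally show ?thesis
      using True by (simp add: w_def)
  qed
  let ?X = "\<Phi> s + ennreal (2 * R + 2)"
  have "nn_expect \<infinity> (sample_step G adj c hubs d_r f_r u i s) \<Phi> = nn_expect \<infinity> (sqrt_walk G c u) (\<lambda>x. nn_expect \<infinity> (cont x) \<Phi>)"
    unfolding sample_step_def nn_expect_bind cont_def ..
  also have "\<dots> \<le> nn_expect \<infinity> (sqrt_walk G c u) (\<lambda>(t, xs). ?X + 5 * of_nat (length xs)
      + (if t then g (last xs) else 0))"
  proof (rule nn_expect_mono)
    fix x assume "x \<in> set_spmf (sqrt_walk G c u)"
    then have "snd x \<noteq> []"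
      using set_sqrt_walk[of "fst x" "snd x"] u by simp
    from cont[OF this, of "fst x"]
    show "nn_expect \<infinity> (cont x) \<Phi> \<le> (case x of (t, xs) \<Rightarrow> ?X + 5 * of_nat (length xs)
        + (if t then g (last xs) else 0))"
      by (simp only: prod.collapse case_prod_beta')
  qed
  also have "\<dots> = ?X + 5 * nn_expect \<infinity> (sqrt_walk G c u) (\<lambda>(t, xs). of_nat (length xs))
      + nn_expect \<infinity> (sqrt_walk G c u) (\<lambda>(t, xs). if t then g (last xs) else 0)"
    using lossless_sqrt_walk[of u]
    by (simp add: nn_expect_lossless case_prod_beta' nn_integral_add nn_integral_cmult
        measure_spmf.emeasure_eq_measure lossless_weight_spmfD flip: weight_spmf_def)
  also have "\<dots> \<le> ?X + 5 * ennreal R + (\<Sum>w\<in>pverts G. ennreal (total_term_prob u w) * g w)"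
    by (intro add_mono mult_left_mono expected_walk_length nn_expect_walk_end u) auto
  also have "\<dots> = potential \<epsilon> f_r s + sample_cost \<epsilon> h u + B"
  proof -
    have "ennreal (7 * R + 2) = ennreal (2 * R + 2) + 5 * ennreal R"
    proof -
      have "ennreal (7 * R + 2) = ennreal (2 * R + 2 + 5 * R)"
        by simp
      also have "\<dots> = ennreal (2 * R + 2) + ennreal (5 * R)"
        using R_pos by (intro ennreal_plus) auto
      finally show ?thesis
        using R_pos by (simp add: ennreal_mult)
    qed
    then show ?thesis
      by (simp add: sample_cost_def g_def \<Phi>_def add_ac)
  qed
  finally show ?thesis
    unfolding \<Phi>_def .
qed

text \<open>The final potential pays for \<open>finish\<close> and the initial one is 0; the loop
  rule, applied to both loops, counts the samples in between.\<close>

lemma expected_prsim_query: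
  assumes "u \<in> pverts G" "0 < \<epsilon>"
  shows "expected_cost (prsim_query G adj c \<epsilon> hubs d_r f_r u)
    \<le> of_nat (f_r * d_r) * sample_cost \<epsilon> (1 / (real d_r * real f_r)) u"
proof -
  let ?S = "sample_cost \<epsilon> (1 / (real d_r * real f_r)) u"
  let ?s0 = "\<lparr>eta_pi = (\<lambda>_ _. 0), s_B = (\<lambda>_ _. 0), time = 0\<rparr> :: 'a query_state"
  let ?inner = "\<lambda>i. for_loop [1..<Suc d_r] (\<lambda>_. sample_step G adj c hubs d_r f_r u i)"
  have inner: "nn_expect \<infinity> (?inner i s) (\<lambda>s. potential \<epsilon> f_r s + B)
      \<le> potential \<epsilon> f_r s + of_nat d_r * ?S + B" for i s B
    using nn_expect_for_loop[of \<infinity> "\<lambda>_. sample_step G adj c hubs d_r f_r u i" "potential \<epsilon> f_r" ?S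
        "[1..<Suc d_r]" s B] expected_sample_step[OF assms]
    by (simp del: upt_Suc)
  have "expected_cost (prsim_query G adj c \<epsilon> hubs d_r f_r u)
      \<le> nn_expect \<infinity> (for_loop [1..<Suc f_r] ?inner ?s0) (\<lambda>s. potential \<epsilon> f_r s + 0)"
    unfolding expected_cost_conv prsim_query_def nn_expect_map
    using finish_le[OF assms(2)] by (intro nn_expect_mono) (simp add: case_prod_beta')
  also have "\<dots> \<le> potential \<epsilon> f_r ?s0 + of_nat (length [1..<Suc f_r]) * (of_nat d_r * ?S) + 0"
    by (intro nn_expect_for_loop inner)
  also have "potential \<epsilon> f_r ?s0 = 0"
    by (simp add: potential_def read_bound_def case_prod_beta')
  finally show ?thesis
    by (simp add: mult.assoc del: upt_Suc)
qed

section \<open>Averaging over the query node, and the final constant\<close>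

lemma sum_sample_cost:
  assumes "0 \<le> h"
  shows "(\<Sum>u\<in>pverts G. sample_cost \<epsilon> h u) = ennreal (real (card (pverts G)) * (7 * R + 2)
    + (2 * h * (c1 c / \<epsilon>)\<^sup>2 + 16 * R) * (\<Sum>w\<in>pverts G. (n_pagerank w)\<^sup>2))"
proof -
  define \<gamma> where "\<gamma> = 2 * h * (c1 c / \<epsilon>)\<^sup>2 + 16 * R"
  have \<gamma>: "0 \<le> \<gamma>"
    using assms R_pos by (simp add: \<gamma>_def)
  have nonneg: "0 \<le> total_term_prob u w * (\<gamma> * n_pagerank w)" for u w
    using \<gamma> by (intro mult_nonneg_nonneg total_term_prob_nonneg n_pagerank_nonneg)
  have "sample_cost \<epsilon> h u
      = ennreal (7 * R + 2 + (\<Sum>w\<in>pverts G. total_term_prob u w * (\<gamma> * n_pagerank w)))" for u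
  proof -
    have "(\<Sum>w\<in>pverts G. ennreal (total_term_prob u w) * ennreal (\<gamma> * n_pagerank w))
        = ennreal (\<Sum>w\<in>pverts G. total_term_prob u w * (\<gamma> * n_pagerank w))"
      using nonneg by (simp add: ennreal_mult' total_term_prob_nonneg flip: sum_ennreal)
    then show ?thesis
      using R_pos nonneg by (simp add: sample_cost_def \<gamma>_def[symmetric] ennreal_plus sum_nonneg)
  qed
  then have "(\<Sum>u\<in>pverts G. sample_cost \<epsilon> h u)
      = ennreal (\<Sum>u\<in>pverts G. 7 * R + 2 + (\<Sum>w\<in>pverts G. total_term_prob u w * (\<gamma> * n_pagerank w)))"
    using R_pos nonneg by (simp only:) (intro sum_ennreal add_nonneg_nonneg sum_nonneg; simp)
  \<comment> \<open>This is where the squares arise: summed over \<open>u\<close>, the rate at which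
    \<open>w\<close> is sampled becomes \<open>n_pagerank w\<close>, and so does, up to
    \<open>\<gamma>\<close>, the cost of each such sample.\<close>
  also have "(\<Sum>u\<in>pverts G. \<Sum>w\<in>pverts G. total_term_prob u w * (\<gamma> * n_pagerank w))
      = (\<Sum>w\<in>pverts G. n_pagerank w * (\<gamma> * n_pagerank w))"
    by (subst sum.swap) (simp add: n_pagerank_def[of _] sum_distrib_right)
  then have "(\<Sum>u\<in>pverts G. 7 * R + 2 + (\<Sum>w\<in>pverts G. total_term_prob u w * (\<gamma> * n_pagerank w)))
      = real (card (pverts G)) * (7 * R + 2) + \<gamma> * (\<Sum>w\<in>pverts G. (n_pagerank w)\<^sup>2)"
    by (simp add: sum.distrib sum_distrib_left power2_eq_square mult_ac)
  finally show ?thesis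
    by (simp add: \<gamma>_def)
qed

text \<open>This absorbs the part of the sampling cost that does not depend on \<open>w\<close>. It
  follows from the lower bound \<open>n_pagerank_ge\<close> at each of the \<open>n\<close>
  nodes.\<close>

lemma sum_reverse_pagerank_ge:
  assumes "pverts G \<noteq> {}"
  shows "1 \<le> R\<^sup>2 * (real (card (pverts G)) * (\<Sum>w\<in>pverts G. (reverse_pagerank G c w)\<^sup>2))"
proof -
  define n where "n = real (card (pverts G))"
  have n: "0 < n"
    using assms finite_pverts by (simp add: n_def card_gt_0_iff)
  have "n * (1 - sqrt c)\<^sup>2 \<le> (\<Sum>w\<in>pverts G. (n_pagerank w)\<^sup>2)"
    unfolding n_def using sqrt_c by (intro sum_bounded_below power_mono n_pagerank_ge) auto
  moreover have "(\<Sum>w\<in>pverts G. (n_pagerank w)\<^sup>2) = n * (n * (\<Sum>w\<in>pverts G. (reverse_pagerank G c w)\<^sup>2))"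
    using n by (simp add: reverse_pagerank_conv power_divide n_def power2_eq_square
        flip: sum_divide_distrib)
  ultimately have "(1 - sqrt c)\<^sup>2 \<le> n * (\<Sum>w\<in>pverts G. (reverse_pagerank G c w)\<^sup>2)"
    using n by (simp only: mult_le_cancel_left_pos)
  from mult_left_mono[OF this, of "R\<^sup>2"] show ?thesis
    by (simp add: n_def R_mult flip: power_mult_distrib)
qed

end

text \<open>A positive count forces \<open>1 \<le> x\<close>, and then even the rounded-up value is
  at most \<open>x + 1 \<le> 2 * x\<close>.\<close>

lemma loop_countD:
  assumes "loop_count x k" "0 < k"
  shows "1 \<le> x" "real k \<le> 2 * x"
  using assms unfolding loop_count_def by linarith+

lemma (in backward_walks) expected_total_cost:
  assumes n: "n = card (pverts G)" "1 \<le> n" and "0 < \<epsilon>"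
    and d_r: "loop_count (c1 c / \<epsilon>\<^sup>2) d_r" and f_r: "loop_count (3 * ln (real n / \<delta>)) f_r"
  shows "expected_cost (bind_spmf (spmf_of_set (pverts G)) (prsim_query G adj c \<epsilon> hubs d_r f_r))
    \<le> ennreal ((12 * c1 c * ((7 * R + 2) * R\<^sup>2 + 16 * R) + 6 * (c1 c)\<^sup>2) *
        (real n * ln (real n / \<delta>) / \<epsilon>\<^sup>2 * (\<Sum>w\<in>pverts G. (reverse_pagerank G c w)\<^sup>2)))"
proof -
  define h where "h = 1 / (real d_r * real f_r)"
  define Q where "Q = real n * (\<Sum>w\<in>pverts G. (reverse_pagerank G c w)\<^sup>2)"
  define L where "L = ln (real n / \<delta>)"
  have ne: "pverts G \<noteq> {}"
    using n by auto
  have Q: "(\<Sum>w\<in>pverts G. (n_pagerank w)\<^sup>2) = real n * Q" "1 \<le> R\<^sup>2 * Q" "0 \<le> Q"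
    using n sum_reverse_pagerank_ge[OF ne]
    by (auto simp: Q_def reverse_pagerank_conv power_divide power2_eq_square sum_nonneg
        simp flip: sum_divide_distrib)
  have "expected_cost (bind_spmf (spmf_of_set (pverts G)) (prsim_query G adj c \<epsilon> hubs d_r f_r))
      = (\<Sum>u\<in>pverts G. expected_cost (prsim_query G adj c \<epsilon> hubs d_r f_r u)) / of_nat n"
    using ne finite_pverts n
    by (simp add: expected_cost_conv nn_expect_bind nn_expect_spmf_of_set)
  also have "\<dots> \<le> (\<Sum>u\<in>pverts G. of_nat (f_r * d_r) * sample_cost \<epsilon> h u) / of_nat n"
    using expected_prsim_query[OF _ \<open>0 < \<epsilon>\<close>] unfolding h_def
    by (intro divide_right_mono_ennreal sum_mono) auto
  also have "\<dots> = of_nat (f_r * d_r) * (\<Sum>u\<in>pverts G. sample_cost \<epsilon> h u) / of_nat n"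
    by (simp add: sum_distrib_left)
  also have "\<dots> = ennreal (real (f_r * d_r) *
      (real n * (7 * R + 2) + (2 * h * (c1 c / \<epsilon>)\<^sup>2 + 16 * R) * (real n * Q)) / real n)"
  proof -
    have "of_nat m * ennreal A / of_nat n = ennreal (real m * A / real n)" if "0 \<le> A" for m A
      using that n by (simp add: ennreal_of_nat_eq_real_of_nat divide_ennreal flip: ennreal_mult)
    moreover have "0 \<le> real n * (7 * R + 2) + (2 * h * (c1 c / \<epsilon>)\<^sup>2 + 16 * R) * (real n * Q)"
      using R_pos Q by (intro add_nonneg_nonneg mult_nonneg_nonneg) (auto simp: h_def)
    ultimately show ?thesis
      by (subst sum_sample_cost) (simp add: h_def, simp only: Q n(1)[symmetric])
  qed
  also have "\<dots> \<le> ennreal ((12 * c1 c * ((7 * R + 2) * R\<^sup>2 + 16 * R) + 6 * (c1 c)\<^sup>2) * (L / \<epsilon>\<^sup>2 * Q))"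
  \<comment> \<open>If a loop is empty, no sample is taken and the left-hand side is 0; otherwise
    both loop bounds are at least 1, which bounds the logarithm from below.\<close>
  proof (cases "f_r = 0 \<or> d_r = 0")
    case False
    define X where "X = L / \<epsilon>\<^sup>2"
    have bounds: "1 \<le> 3 * L" "real f_r \<le> 6 * L" "real d_r \<le> 2 * (c1 c / \<epsilon>\<^sup>2)"
      using loop_countD[OF d_r] loop_countD[OF f_r] False by (auto simp: L_def)
    have X: "0 \<le> X"
      using bounds by (simp add: X_def)
    have "real f_r * real d_r \<le> (6 * L) * (2 * (c1 c / \<epsilon>\<^sup>2))"
      using bounds by (intro mult_mono) auto
    then have N: "real f_r * real d_r \<le> 12 * c1 c * X"
      by (simp add: X_def mult_ac)
    \<comment> \<open>In the index term \<open>h\<close> cancels the number of samples, leaving no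
      logarithm. It is restored by \<open>1 \<le> 3 * L\<close>, whence the 6 = 2 * 3 before
      \<open>(c1 c)\<^sup>2\<close>.\<close>
    have "1 / \<epsilon>\<^sup>2 \<le> 3 * X"
      using bounds \<open>0 < \<epsilon>\<close> by (simp add: X_def field_simps)
    then have idx: "(c1 c)\<^sup>2 * Q * (1 / \<epsilon>\<^sup>2) \<le> (c1 c)\<^sup>2 * Q * (3 * X)"
      using Q by (intro mult_left_mono) auto
    have one: "7 * R + 2 \<le> (7 * R + 2) * (R\<^sup>2 * Q)"
      using Q R_pos mult_left_mono[of 1 "R\<^sup>2 * Q" "7 * R + 2"] by simp
    have "real (f_r * d_r) * (real n * (7 * R + 2) + (2 * h * (c1 c / \<epsilon>)\<^sup>2 + 16 * R) * (real n * Q)) / real n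
        = real f_r * real d_r * (7 * R + 2 + 16 * R * Q) + 2 * ((c1 c)\<^sup>2 * Q * (1 / \<epsilon>\<^sup>2))"
      using n False by (simp add: h_def field_simps)
    also have "\<dots> \<le> real f_r * real d_r * ((7 * R + 2) * (R\<^sup>2 * Q) + 16 * R * Q) + 2 * ((c1 c)\<^sup>2 * Q * (3 * X))"
      by (intro add_mono mult_left_mono[OF add_right_mono[OF one]] mult_left_mono[OF idx]) simp_all
    also have "\<dots> \<le> 12 * c1 c * X * ((7 * R + 2) * (R\<^sup>2 * Q) + 16 * R * Q) + 2 * ((c1 c)\<^sup>2 * Q * (3 * X))"
      using N Q R_pos by (intro add_right_mono mult_right_mono) auto
    also have "\<dots> = (12 * c1 c * ((7 * R + 2) * R\<^sup>2 + 16 * R) + 6 * (c1 c)\<^sup>2) * (X * Q)"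
      by (simp add: algebra_simps)
    finally show ?thesis
      unfolding X_def by (rule ennreal_leI)
  qed auto
  also have "L / \<epsilon>\<^sup>2 * Q
      = real n * ln (real n / \<delta>) / \<epsilon>\<^sup>2 * (\<Sum>w\<in>pverts G. (reverse_pagerank G c w)\<^sup>2)"
    by (simp add: L_def Q_def)
  finally show ?thesis .
qed

theorem theorem3p11:
  fixes c :: real
  assumes "0 < c" and "c < 1"
  shows "\<exists>K>0. \<forall>(G :: 'v pair_pre_digraph) adj ws n j0 (\<epsilon> :: real) (\<delta> :: real) d_r f_r.
    pair_fin_digraph G \<and> n = card (pverts G) \<and> n \<ge> 1 \<and>
    sorted_out_adjacency G adj \<and> pagerank_order G c ws \<and> j0 \<in> {0..n} \<and>
    0 < \<epsilon> \<and> 0 < \<delta> \<and> \<delta> < 1 \<and>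
    loop_count (c1 c / \<epsilon>\<^sup>2) d_r \<and> loop_count (3 * ln (real n / \<delta>)) f_r \<longrightarrow>
    expected_cost (bind_spmf (spmf_of_set (pverts G))
      (prsim_query G adj c \<epsilon> (set (take j0 ws)) d_r f_r))
    \<le> ennreal (K * (real n * ln (real n / \<delta>) / \<epsilon>\<^sup>2 *
        (\<Sum>w\<in>pverts G. (reverse_pagerank G c w)\<^sup>2)))"
proof -
  \<comment> \<open>The value of \<open>R\<close>, written out because the constant has to be fixed
    before any graph is given.\<close>
  define r where "r = 1 / (1 - sqrt c)"
  let ?K = "12 * c1 c * ((7 * r + 2) * r\<^sup>2 + 16 * r) + 6 * (c1 c)\<^sup>2"
  have "0 < c1 c" "0 < r"
    using assms by (auto simp: c1_def r_def)
  then have "0 < ?K"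
    by (intro add_pos_pos mult_pos_pos) auto
  moreover have "expected_cost (bind_spmf (spmf_of_set (pverts G)) (prsim_query G adj c \<epsilon> hubs d_r f_r))
      \<le> ennreal (?K * (real n * ln (real n / \<delta>) / \<epsilon>\<^sup>2 * (\<Sum>w\<in>pverts G. (reverse_pagerank G c w)\<^sup>2)))"
    if "pair_fin_digraph G" "sorted_out_adjacency G adj" "n = card (pverts G)" "1 \<le> n" "0 < \<epsilon>"
      "loop_count (c1 c / \<epsilon>\<^sup>2) d_r" "loop_count (3 * ln (real n / \<delta>)) f_r"
    for G :: "'v pair_pre_digraph" and adj n hubs \<epsilon> \<delta> d_r f_r
  proof -
    interpret backward_walks G c adj
      using assms that by (intro backward_walks.intro sqrt_walks.intro backward_walks_axioms.intro) auto
    show ?thesis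
      using expected_total_cost[OF that(3-7)] by (simp only: r_def R_def)
  qed
  ultimately show ?thesis
    by (intro exI[of _ ?K]) simp
qed

end
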